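(* For every Penrose rhombic tiling $\mathcal{T}$ of the plane, with vertex set $V(\mathcal{T})$, there exists a frieze pattern $f\colon V(\mathcal{T})\to\mathbb{Z}_{>0}$ on $\mathcal{T}$ that takes exactly four distinct values.
   Context: Rhombuses. All rhombuses have unit side length (up to an overall similarity). The thick rhombus has interior angles $72^\circ$ and $108^\circ$; the thin rhombus has interior angles $36^\circ$ and $144^\circ$. Penrose rhombic tilings. Identify the plane with $\mathbb{C}$ and let $\zeta=e^{2\pi i/5}$. Let $\gamma_0,\dots,\gamma_4\in\mathbb{R}$ with $\sum_{j=0}^4\gamma_j=0$, and consider the five families of lines $\{z\in\mathbb{C} : \mathrm{Re}(z\zeta^{-j})+\gamma_j=k\}$, $k\in\mathbb{Z}$, $j=0,\dots,4$ (a pentagrid). Assume that no three of these lines meet in a common point (the pentagrid is regular). Put $K_j(z)=\lceil \mathrm{Re}(z\zeta^{-j})+\gamma_j\rceil$. To each intersection point $z_0$ of a line of family $r$ with a line of family $s$ ($r\neq s$) associate the rhombus with the four vertices $\sum_{j=0}^4 K_j(z_0)\zeta^j+\epsilon_1\zeta^r+\epsilon_2\zeta^s$, $\epsilon_1,\epsilon_2\in\{0,1\}$. The collection of all these rhombuses is an edge-to-edge tiling of the plane by thick and thin rhombuses, called the tiling of the regular pentagrid. A Penrose rhombic tiling is (up to similarity) an edge-to-edge tiling of the plane by thick and thin rhombuses each of whose finite patches occurs, up to translation, in the tiling of some regular pentagrid. (All Penrose rhombic tilings are locally indistinguishable.) Frieze pattern. A frieze pattern on a tiling $\mathcal{T}$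 by thick and thin rhombuses is a map $f$ from the set $V(\mathcal{T})$ of vertices of the tiles to the positive integers such that every tile satisfies the diamond rule $bc-ad=1$. Here $a,d$ are the values of $f$ at one pair of opposite vertices and $b,c$ are the values at the other pair, where: for a thick rhombus, $a,d$ are the values at the two $72^\circ$ corners and $b,c$ those at the two $108^\circ$ corners; for a thin rhombus, $a,d$ are the values at the two $144^\circ$ corners and $b,c$ those at the two $36^\circ$ corners. *)

theory Defs
  imports "HOL-Analysis.Analysis"
begin

section \<open>Rhombuses and tilings\<close>

definition angle_at :: "complex \<Rightarrow> complex \<Rightarrow> complex \<Rightarrow> real" where
  "angle_at p q r = arccos (((q - p) \<bullet> (r - p)) / (norm (q - p) * norm (r - p)))"

text \<open>The corners of a rhombus are listed in cyclic order \<open>p, q, r, s\<close>; \<open>l\<close> is the side length and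
  \<open>\<alpha>\<close> the interior angle at \<open>p\<close>, hence also at \<open>r\<close>.  No orientation is fixed.\<close>

definition rhombus :: "real \<Rightarrow> real \<Rightarrow> complex \<Rightarrow> complex \<Rightarrow> complex \<Rightarrow> complex \<Rightarrow> bool" where
  "rhombus l \<alpha> p q r s \<longleftrightarrow>
     0 < l \<and> dist p q = l \<and> dist p s = l \<and> q - p = r - s \<and> angle_at p q s = \<alpha>"

text \<open>A thick rhombus is listed starting from a corner of 72 degrees, a thin one starting from a
  corner of 144 degrees.\<close>

definition thick_rhombus :: "real \<Rightarrow> complex \<Rightarrow> complex \<Rightarrow> complex \<Rightarrow> complex \<Rightarrow> bool" where
  "thick_rhombus l p q r s \<longleftrightarrow> rhombus l (2 * pi / 5) p q r s"

definition thin_rhombus :: "real \<Rightarrow> complex \<Rightarrow> complex \<Rightarrow> complex \<Rightarrow> complex \<Rightarrow> bool" where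
  "thin_rhombus l p q r s \<longleftrightarrow> rhombus l (4 * pi / 5) p q r s"

text \<open>Tiles are closed regions of the plane.\<close>

definition rhombic_tile :: "real \<Rightarrow> complex set \<Rightarrow> bool" where
  "rhombic_tile l R \<longleftrightarrow>
     (\<exists>p q r s. (thick_rhombus l p q r s \<or> thin_rhombus l p q r s) \<and> R = convex hull {p, q, r, s})"

text \<open>The proper faces of a rhombus are the empty set, its corners and its sides, so the condition
  with \<open>face_of\<close> says that distinct tiles are disjoint or share exactly a corner or a full side.\<close>

definition rhombic_tiling :: "real \<Rightarrow> complex set set \<Rightarrow> bool" where
  "rhombic_tiling l T \<longleftrightarrow>
     (\<forall>R\<in>T. rhombic_tile l R) \<and> \<Union>T = UNIV \<and>
     (\<forall>R\<in>T. \<forall>S\<in>T. R \<noteq> S \<longrightarrow>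
        interior R \<inter> interior S = {} \<and> (R \<inter> S) face_of R \<and> (R \<inter> S) face_of S)"

definition tiling_vertices :: "complex set set \<Rightarrow> complex set" where
  "tiling_vertices T = {v. \<exists>R\<in>T. v extreme_point_of R}"


section \<open>Pentagrids and Penrose rhombic tilings\<close>

definition zeta5 :: complex where
  "zeta5 = exp (2 * of_real pi * \<i> / 5)"

text \<open>Only the shifts \<open>\<gamma> j\<close> with \<open>j < 5\<close> are relevant.\<close>

definition grid_line :: "(nat \<Rightarrow> real) \<Rightarrow> nat \<Rightarrow> int \<Rightarrow> complex set" where
  "grid_line \<gamma> j k = {z. Re (z / zeta5 ^ j) + \<gamma> j = of_int k}"

definition pentagrid :: "(nat \<Rightarrow> real) \<Rightarrow> complex set set" where
  "pentagrid \<gamma> = {grid_line \<gamma> j k | j k. j < 5}"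

definition regular_pentagrid :: "(nat \<Rightarrow> real) \<Rightarrow> bool" where
  "regular_pentagrid \<gamma> \<longleftrightarrow>
     (\<Sum>j<5. \<gamma> j) = 0 \<and>
     \<not> (\<exists>L1\<in>pentagrid \<gamma>. \<exists>L2\<in>pentagrid \<gamma>. \<exists>L3\<in>pentagrid \<gamma>.
          L1 \<noteq> L2 \<and> L1 \<noteq> L3 \<and> L2 \<noteq> L3 \<and> L1 \<inter> L2 \<inter> L3 \<noteq> {})"

definition grid_index :: "(nat \<Rightarrow> real) \<Rightarrow> nat \<Rightarrow> complex \<Rightarrow> int" where
  "grid_index \<gamma> j z = \<lceil>Re (z / zeta5 ^ j) + \<gamma> j\<rceil>"

definition base_vertex :: "(nat \<Rightarrow> real) \<Rightarrow> complex \<Rightarrow> complex" where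
  "base_vertex \<gamma> z = (\<Sum>j<5. of_int (grid_index \<gamma> j z) * zeta5 ^ j)"

definition pentagrid_tile :: "(nat \<Rightarrow> real) \<Rightarrow> nat \<Rightarrow> nat \<Rightarrow> complex \<Rightarrow> complex set" where
  "pentagrid_tile \<gamma> r s z = convex hull
     {base_vertex \<gamma> z, base_vertex \<gamma> z + zeta5 ^ r,
      base_vertex \<gamma> z + zeta5 ^ s, base_vertex \<gamma> z + zeta5 ^ r + zeta5 ^ s}"

definition pentagrid_tiling :: "(nat \<Rightarrow> real) \<Rightarrow> complex set set" where
  "pentagrid_tiling \<gamma> =
     {pentagrid_tile \<gamma> r s z | r s z. r < 5 \<and> s < 5 \<and> r \<noteq> s \<and>
        (\<exists>k m. z \<in> grid_line \<gamma> r k \<inter> grid_line \<gamma> s m)}"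

text \<open>A finite patch is a finite set of tiles.\<close>

definition unit_penrose_tiling :: "complex set set \<Rightarrow> bool" where
  "unit_penrose_tiling T \<longleftrightarrow>
     rhombic_tiling 1 T \<and>
     (\<forall>P. P \<subseteq> T \<and> finite P \<longrightarrow>
        (\<exists>\<gamma> t. regular_pentagrid \<gamma> \<and> (\<lambda>R. (+) t ` R) ` P \<subseteq> pentagrid_tiling \<gamma>))"

definition similarity :: "(complex \<Rightarrow> complex) \<Rightarrow> bool" where
  "similarity \<phi> \<longleftrightarrow> (\<exists>c>0. \<forall>z w. dist (\<phi> z) (\<phi> w) = c * dist z w)"

definition penrose_tiling :: "complex set set \<Rightarrow> bool" where
  "penrose_tiling T \<longleftrightarrow>
     (\<exists>\<phi> T0. similarity \<phi> \<and> unit_penrose_tiling T0 \<and> T = (\<lambda>R. \<phi> ` R) ` T0)"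


section \<open>Frieze patterns\<close>

text \<open>With the corners listed as above, \<open>a, d\<close> are the corners of 72 degrees of a thick rhombus and
  those of 144 degrees of a thin one.  Values of \<open>f\<close> off the vertex set are irrelevant.\<close>

definition frieze_pattern :: "complex set set \<Rightarrow> (complex \<Rightarrow> int) \<Rightarrow> bool" where
  "frieze_pattern T f \<longleftrightarrow>
     (\<forall>v\<in>tiling_vertices T. 0 < f v) \<and>
     (\<forall>l a b d c. convex hull {a, b, d, c} \<in> T \<and>
        (thick_rhombus l a b d c \<or> thin_rhombus l a b d c) \<longrightarrow>
        f b * f c - f a * f d = 1)"

end

theory Submission imports Defs "HOL-Analysis.Isolated"
begin

text \<open>The frieze pattern is the index of de Bruijn.  The corners of the pentagrid tile of a crossing
  of families \<open>r\<close> and \<open>s\<close> are \<open>\<Sum> k\<^sub>j \<zeta>\<^sup>j\<close> for the integer vectors \<open>K\<close>, \<open>K + e\<^sub>r\<close>, \<open>K + e\<^sub>s\<close> and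
  \<open>K + e\<^sub>r + e\<^sub>s\<close>; call the coordinate sum of such a vector the index of the corner.  If \<open>i\<close> is the
  index of the base corner, the four indices are \<open>i\<close>, \<open>i + 1\<close>, \<open>i + 1\<close>, \<open>i + 2\<close>.  The angle at the base
  corner is 72 degrees in a thick and 144 degrees in a thin tile, so in both cases the two corners of
  index \<open>i + 1\<close> are the ones whose values are called \<open>b, c\<close> (\<open>corners_of_tile\<close>), and
  \<open>(i + 1)\<^sup>2 - i (i + 2) = 1\<close> is the diamond rule.

  The values are positive and at most four in number.  The five grid coordinates of a crossing sum to
  0, the two integral ones are their own ceilings, and each of the other three lies less than 1, but
  not 0, below its ceiling.  So \<open>i\<close> is strictly between 0 and 3 (\<open>crossing_index_sum\<close>), and all
  indices lie between 1 and 4.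

  A Penrose tiling is known only through its finite patches, so the index must be read off from the
  points.  As \<open>\<tau> = 2 cos (2 \<pi> / 5)\<close> is irrational, the only linear relation over the integers between
  the fifth roots of unity is that their sum vanishes; hence the index modulo 5 of a point is well
  defined (\<open>index_lattice_point\<close>).  Only five normalisations of it are possible on the whole tiling,
  and if each of them assigned the residue 0 to some vertex, then five such vertices would lie in a
  common finite patch, which a pentagrid forbids (\<open>index_normalisation\<close>).

  It remains to see that no value is missed.  Otherwise all tiles would have the same base index
  (\<open>base_constant\<close>).  Tiles that share a side in direction \<open>\<zeta>\<^sup>r\<close> belong to crossings of one line of
  family \<open>r\<close>, and along that line the coordinates of families \<open>r \<plusminus> 2\<close> move \<open>\<tau>\<close> times as fast as those
  of families \<open>r \<plusminus> 1\<close>.  This excludes a thin tile, because it and one of its two neighbours across the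
  sides in a suitable direction cannot have equal base indices (\<open>base_constant_no_thin\<close>).  With thick
  tiles only, a ribbon of five tiles crosses the families \<open>r + 1\<close> and \<open>r - 1\<close> alternately; then the
  coordinate of family \<open>r + 1\<close> moves by 2 and that of family \<open>r + 2\<close> by \<open>2 \<tau> > 1\<close>, so some line of the
  latter family would have been crossed as well (\<open>not_base_constant\<close>).  The neighbours exist since a
  tiling covers the points just beyond every side (\<open>tile_across_side\<close>).\<close>


section \<open>The fifth root of unity\<close>

text \<open>The reciprocal \<open>(sqrt 5 - 1) / 2\<close> of the golden ratio, in the form in which it enters:
  \<open>\<zeta>\<close> is a root of \<open>x\<^sup>2 - \<tau> x + 1\<close>.\<close>

definition tau :: real where "tau = 2 * cos (2 * pi / 5)"

lemma zeta5_eq_cis: "zeta5 = cis (2 * pi / 5)"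
  by (simp add: zeta5_def cis_conv_exp mult_ac)

lemma zeta5_power5: "zeta5 ^ 5 = 1"
proof -
  have "zeta5 ^ 5 = cis (real 5 * (2 * pi / 5))" unfolding zeta5_eq_cis by (rule Complex.DeMoivre)
  also have "real 5 * (2 * pi / 5) = 2 * pi" by simp
  finally show ?thesis by simp
qed

lemma norm_zeta5_power: "norm (zeta5 ^ j) = 1"
  by (simp add: zeta5_eq_cis norm_power)

lemma zeta5_power_nonzero: "zeta5 ^ j \<noteq> 0"
  using norm_zeta5_power[of j] by force

lemma Im_zeta5_nonzero: "Im zeta5 \<noteq> 0"
proof -
  have "0 < sin (2 * pi / 5)" by (rule sin_gt_zero) (auto simp: field_simps)
  then show ?thesis by (simp add: zeta5_eq_cis)
qed

lemma zeta5_power2: "zeta5 ^ 2 = of_real tau * zeta5 - 1"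
proof -
  have "sin (2 * pi / 5) ^ 2 = 1 - cos (2 * pi / 5) ^ 2" by (simp add: sin_squared_eq)
  then show ?thesis
    unfolding zeta5_eq_cis tau_def power2_eq_square by (simp add: complex_eq_iff algebra_simps)
qed

lemma tau_pos: "0 < tau"
  unfolding tau_def using cos_gt_zero[of "2 * pi / 5"] by simp

lemma zeta5_power_Suc2: "zeta5 ^ (Suc (Suc j)) = of_real tau * zeta5 ^ Suc j - zeta5 ^ j"
proof -
  have "zeta5 ^ (Suc (Suc j)) = zeta5 ^ j * zeta5 ^ 2" by (simp add: power2_eq_square)
  then show ?thesis unfolding zeta5_power2 by (simp add: algebra_simps)
qed

text \<open>The angle \<open>\<theta> = 2 * pi / 5\<close> satisfies \<open>cos (3 * \<theta>) = cos (2 * \<theta>)\<close>.\<close>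

lemma tau_square: "tau ^ 2 = 1 - tau"
proof -
  define c where "c = cos (2 * pi / 5)"
  have e: "3 * (2 * pi / 5) = 2 * pi - 2 * (2 * pi / 5)" by simp
  have "cos (3 * (2 * pi / 5)) = cos (2 * pi - 2 * (2 * pi / 5))"
    by (rule arg_cong[where f=cos]) (rule e)
  also have "\<dots> = cos (2 * (2 * pi / 5))" unfolding cos_diff by simp
  finally have "4 * c ^ 3 - 3 * c = 2 * c\<^sup>2 - 1"
    unfolding cos_treble_cos cos_double_cos c_def .
  then have "(c - 1) * (4 * c^2 + 2 * c - 1) = 0"
    by (simp add: algebra_simps power2_eq_square power3_eq_cube)
  moreover have "c \<noteq> 1"
  proof
    assume "c = 1"
    then have "cos (2 * pi / 5) = cos 0" unfolding c_def by simp
    then show False using cos_monotone_0_pi[of 0 "2 * pi / 5"] by simp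
  qed
  ultimately have "4 * c^2 + 2 * c - 1 = 0" by simp
  then show ?thesis unfolding tau_def c_def[symmetric] by (simp add: power2_eq_square)
qed

lemma tau_less_1: "tau < 1" and tau_gt_half: "1 < 2 * tau"
proof -
  have sq: "tau * tau = 1 - tau" using tau_square by (simp add: power2_eq_square)
  show "tau < 1" using sq tau_pos by (smt (verit) mult_pos_pos)
  show "1 < 2 * tau"
  proof (rule ccontr)
    assume a: "\<not> ?thesis"
    then have "tau * tau \<le> 1/2 * (1/2)" using tau_pos by (intro mult_mono) auto
    then show False using sq a by auto
  qed
qed

text \<open>Infinite descent: modulo 2 the equation forces both numbers to be even.\<close>

lemma golden_equation_int:
  fixes a b :: int
  assumes "a * a = a * b + b * b"
  shows "a = 0 \<and> b = 0"
  using assms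
proof (induction "nat \<bar>a\<bar> + nat \<bar>b\<bar>" arbitrary: a b rule: less_induct)
  case less
  have "even (a * a) = even (a * b + b * b)" using less.prems by (rule arg_cong)
  then have "even a" "even b" by (cases "even a"; cases "even b"; simp)+
  then obtain c d where cd: "a = 2 * c" "b = 2 * d" by (auto elim!: evenE)
  show ?case
  proof (rule ccontr)
    assume "\<not> ?case"
    then have "nat \<bar>c\<bar> + nat \<bar>d\<bar> < nat \<bar>a\<bar> + nat \<bar>b\<bar>" using cd by linarith
    moreover have "c * c = c * d + d * d" using less.prems unfolding cd by simp
    ultimately have "c = 0 \<and> d = 0" using less.hyps by blast
    then show False using cd \<open>\<not> ?case\<close> by simp
  qed
qed

lemma tau_independent:
  fixes a b :: int
  assumes "of_int a + of_int b * tau = 0"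
  shows "a = 0 \<and> b = 0"
proof -
  \<comment> \<open>the norm from the field generated by \<open>\<tau>\<close>, whose other conjugate is \<open>- 1 - \<tau>\<close>\<close>
  have "(of_int a + of_int b * tau) * (of_int a - of_int b - of_int b * tau) = 0"
    using assms by simp
  then have "(of_int a)^2 - of_int a * of_int b - (of_int b)^2 * (tau + tau^2) = 0"
    by (simp add: algebra_simps power2_eq_square)
  then have "real_of_int (a * a) = of_int (a * b + b * b)"
    unfolding tau_square by (simp add: power2_eq_square)
  then show ?thesis using golden_equation_int of_int_eq_iff by blast
qed

lemma less_5_cases: "(j::nat) < 5 \<longleftrightarrow> j = 0 \<or> j = 1 \<or> j = 2 \<or> j = 3 \<or> j = 4" by auto

lemma sum_5: "(\<Sum>j<5::nat. f j) = f 0 + f 1 + f 2 + f 3 + (f 4 :: 'a::comm_monoid_add)"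
  by (simp add: numeral_eq_Suc)

lemma zeta5_powers:
  "zeta5 ^ 3 = - of_real tau * zeta5 - of_real tau" "zeta5 ^ 4 = of_real tau - zeta5"
proof -
  let ?t = "of_real tau :: complex"
  have t: "?t * ?t = 1 - ?t" using tau_square
    by (metis of_real_1 of_real_diff of_real_mult power2_eq_square)
  have "zeta5 ^ 3 = ?t * zeta5 ^ 2 - zeta5"
    using zeta5_power_Suc2[of 1] by (simp add: numeral_eq_Suc)
  also have "\<dots> = (?t * ?t - 1) * zeta5 - ?t" unfolding zeta5_power2 by (simp add: algebra_simps)
  finally show 3: "zeta5 ^ 3 = - ?t * zeta5 - ?t" unfolding t by (simp add: algebra_simps)
  have "zeta5 ^ 4 = ?t * zeta5 ^ 3 - zeta5 ^ 2"
    using zeta5_power_Suc2[of 2] by (simp add: numeral_eq_Suc)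
  also have "\<dots> = - (?t * ?t) * (zeta5 + 1) - ?t * zeta5 + 1"
    unfolding 3 zeta5_power2 by (simp add: algebra_simps)
  finally show "zeta5 ^ 4 = ?t - zeta5" unfolding t by (simp add: algebra_simps)
qed

lemma sum_zeta5_powers: "(\<Sum>j<5. zeta5 ^ j) = 0"
  unfolding sum_5 by (simp add: zeta5_powers zeta5_power2 algebra_simps)

lemma zeta5_power_mod: "zeta5 ^ (n mod 5) = zeta5 ^ n"
proof -
  have "zeta5 ^ n = zeta5 ^ (5 * (n div 5) + n mod 5)" by simp
  also have "\<dots> = zeta5 ^ (n mod 5)" unfolding power_add power_mult zeta5_power5 by simp
  finally show ?thesis ..
qed

lemma Re_zeta5: "Re zeta5 = tau / 2" by (simp add: zeta5_eq_cis tau_def)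

lemma cnj_zeta5: "cnj zeta5 = zeta5 ^ 4"
  unfolding zeta5_powers by (simp add: complex_eq_iff Re_zeta5)

text \<open>These are the cosines of 72 and 144 degrees.\<close>

lemma inner_zeta5_powers:
  assumes "r < 5" "s < 5" "r \<noteq> s"
  shows "zeta5 ^ r \<bullet> zeta5 ^ s \<in> {tau / 2, - (1 + tau) / 2}"
proof -
  have "zeta5 ^ r \<bullet> zeta5 ^ s = Re (zeta5 ^ r * cnj (zeta5 ^ s))"
    unfolding inner_complex_def by (simp del: complex_cnj_power)
  also have "zeta5 ^ r * cnj (zeta5 ^ s) = zeta5 ^ ((r + 4 * s) mod 5)"
    by (simp add: cnj_zeta5 zeta5_power_mod power_add power_mult)
  finally have *: "zeta5 ^ r \<bullet> zeta5 ^ s = Re (zeta5 ^ ((r + 4 * s) mod 5))" .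
  have t: "tau * tau = 1 - tau" using tau_square by (simp add: power2_eq_square)
  have "(r + 4 * s) mod 5 \<in> {1,2,3,4}" using assms unfolding less_5_cases by auto
  moreover have "Re (zeta5 ^ 1) = tau / 2" "Re (zeta5 ^ 2) = - (1 + tau) / 2"
    "Re (zeta5 ^ 3) = - (1 + tau) / 2" "Re (zeta5 ^ 4) = tau / 2"
    using t by (simp_all add: zeta5_power2 zeta5_powers Re_zeta5 field_simps)
  ultimately show ?thesis unfolding * by auto
qed

lemma abs_inner_zeta5_powers:
  assumes "r < 5" "s < 5" "r \<noteq> s"
  shows "\<bar>zeta5 ^ r \<bullet> zeta5 ^ s\<bar> < 1"
  using inner_zeta5_powers[OF assms] tau_pos tau_less_1 by auto

lemma zeta5_power_inj:
  assumes "r < 5" "s < 5" "zeta5 ^ r = zeta5 ^ s"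
  shows "r = s"
  using abs_inner_zeta5_powers[of r s] assms norm_zeta5_power[of s]
  by (auto simp: dot_square_norm)


section \<open>The lattice of the fifth roots of unity and the index\<close>

definition lattice_point :: "(nat \<Rightarrow> int) \<Rightarrow> complex" where
  "lattice_point k = (\<Sum>j<5. of_int (k j) * zeta5 ^ j)"

abbreviation "lattice \<equiv> range lattice_point"

text \<open>The coordinate vectors of a lattice point differ by constant vectors, so only the residue
  modulo 5 of the coordinate sum belongs to the point.  Off the lattice the value is arbitrary.\<close>

definition index :: "complex \<Rightarrow> int" where
  "index x = (\<Sum>j<5. (SOME k. lattice_point k = x) j) mod 5"

text \<open>In the real basis \<open>1, \<zeta>\<close> of the plane the point has coordinates in \<open>\<int>[\<tau>]\<close>, so that its
  vanishing amounts to four equations between integers.\<close>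

lemma lattice_point_zero:
  assumes "lattice_point k = 0" "i < 5" "j < 5"
  shows "k i = k j"
proof -
  define a where "a = of_int (k 0 - k 2) + of_int (k 4 - k 3) * tau"
  define b where "b = of_int (k 1 - k 4) + of_int (k 2 - k 3) * tau"
  have "lattice_point k = of_real a + of_real b * zeta5"
    unfolding lattice_point_def sum_5 a_def b_def
    by (simp add: zeta5_power2 zeta5_powers algebra_simps)
  then have *: "of_real a + of_real b * zeta5 = 0" using assms by simp
  have "Im (of_real a + of_real b * zeta5) = 0" unfolding * by simp
  then have b: "b = 0" using Im_zeta5_nonzero by simp
  with * have a: "a = 0" by simp
  show ?thesis
    using tau_independent[OF a[unfolded a_def]] tau_independent[OF b[unfolded b_def]] assms(2,3)
    unfolding less_5_cases by auto
qed

lemma lattice_point_add: "lattice_point (\<lambda>j. k j + l j) = lattice_point k + lattice_point l"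
  by (simp add: lattice_point_def sum.distrib algebra_simps)

lemma lattice_point_diff: "lattice_point (\<lambda>j. k j - l j) = lattice_point k - lattice_point l"
  by (simp add: lattice_point_def sum_subtractf algebra_simps)

lemma lattice_point_unit:
  assumes "r < 5" shows "lattice_point (\<lambda>j. of_bool (j = r)) = zeta5 ^ r"
proof -
  have "(\<Sum>j<5. of_int (of_bool (j = r)) * zeta5 ^ j) = (\<Sum>j<5. if j = r then zeta5 ^ j else 0)"
    by (rule sum.cong) auto
  also have "\<dots> = zeta5 ^ r" using assms by simp
  finally show ?thesis unfolding lattice_point_def .
qed

lemma index_lattice_point: "index (lattice_point k) = (\<Sum>j<5. k j) mod 5"
proof -
  define l where "l = (SOME l. lattice_point l = lattice_point k)"
  have "lattice_point l = lattice_point k" unfolding l_def by (rule someI[where x=k]) (rule refl)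
  then have "lattice_point (\<lambda>j. l j - k j) = 0" by (simp add: lattice_point_diff)
  then have *: "l j - k j = l 0 - k 0" if "j < 5" for j
    using lattice_point_zero[where k="\<lambda>j. l j - k j" and i=j and j=0] that by simp
  define c where "c = l 0 - k 0"
  have **: "l j = k j + c" if "j < 5" for j using *[OF that] unfolding c_def by linarith
  have "(\<Sum>j<5. l j) = (\<Sum>j<5. k j + c)" by (rule sum.cong) (simp_all add: **)
  also have "\<dots> = (\<Sum>j<5. k j) + 5 * c" by (simp add: sum.distrib)
  finally show ?thesis unfolding index_def l_def[symmetric] by simp
qed

text \<open>The constant vectors are the only ambiguity, and the coordinate sum removes it.\<close>

lemma lattice_point_inj:
  assumes "lattice_point k = lattice_point l" "(\<Sum>j<5. k j) = (\<Sum>j<5. l j)" "j < 5"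
  shows "k j = l j"
proof -
  have "lattice_point (\<lambda>j. l j - k j) = 0" using assms by (simp add: lattice_point_diff)
  then have *: "l i - k i = l j - k j" if "i < 5" for i
    using lattice_point_zero[where k="\<lambda>j. l j - k j" and i=i and j=j] that assms(3) by simp
  have "(\<Sum>i<5::nat. l i - k i) = (\<Sum>i<5::nat. l j - k j)"
    by (rule sum.cong[OF refl]) (rule *, simp)
  then have "5 * (l j - k j) = 0" using assms(2) by (simp add: sum_subtractf)
  then show ?thesis by simp
qed

lemma lattice_add: "x \<in> lattice \<Longrightarrow> y \<in> lattice \<Longrightarrow> x + y \<in> lattice"
  by (auto simp: lattice_point_add[symmetric])

lemma lattice_diff: "x \<in> lattice \<Longrightarrow> y \<in> lattice \<Longrightarrow> x - y \<in> lattice"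
  by (auto simp: lattice_point_diff[symmetric])

lemma lattice_zeta5: "r < 5 \<Longrightarrow> zeta5 ^ r \<in> lattice"
  by (subst lattice_point_unit[symmetric]) auto

lemma index_add: "x \<in> lattice \<Longrightarrow> y \<in> lattice \<Longrightarrow> index (x + y) = (index x + index y) mod 5"
  by (auto simp: lattice_point_add[symmetric] index_lattice_point sum.distrib mod_add_eq)

lemma index_zeta5: "r < 5 \<Longrightarrow> index (zeta5 ^ r) = 1"
  by (subst lattice_point_unit[symmetric]) (auto simp: index_lattice_point sum_5 less_5_cases)

lemma index_add_zeta5: "x \<in> lattice \<Longrightarrow> r < 5 \<Longrightarrow> index (x + zeta5 ^ r) = (index x + 1) mod 5"
  by (simp add: index_add lattice_zeta5 index_zeta5)

lemma index_range: "0 \<le> index x" "index x < 5"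
  by (simp_all add: index_def)

lemma lattice_of_int: "of_int c \<in> lattice" and index_of_int: "index (of_int c) = c mod 5"
proof -
  have *: "of_int c = lattice_point (\<lambda>j. c * of_bool (j = 0))"
    unfolding lattice_point_def sum_5 by simp
  show "of_int c \<in> lattice" unfolding * by simp
  show "index (of_int c) = c mod 5" unfolding * index_lattice_point sum_5 by simp
qed

lemma index_vertices:
  assumes "u \<in> lattice" "r < 5" "s < 5"
  shows "index (u + zeta5 ^ r) = (index u + 1) mod 5"
    "index (u + zeta5 ^ r + zeta5 ^ s) = (index u + 2) mod 5"
    "u + zeta5 ^ r \<in> lattice" "u + zeta5 ^ r + zeta5 ^ s \<in> lattice"
proof -
  show l: "u + zeta5 ^ r \<in> lattice" "u + zeta5 ^ r + zeta5 ^ s \<in> lattice"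
    and 1: "index (u + zeta5 ^ r) = (index u + 1) mod 5"
    using assms by (simp_all add: index_add_zeta5 lattice_add lattice_zeta5)
  show "index (u + zeta5 ^ r + zeta5 ^ s) = (index u + 2) mod 5"
    unfolding index_add_zeta5[OF l(1) assms(3)] 1 by presburger
qed

lemma index_cases: "index x \<in> {0, 1, 2, 3, 4}"
  using index_range[of x] by auto

lemma mod5_close:
  fixes a b :: int
  assumes "a \<in> {0, 1, 2, 3, 4}"
    and "b \<in> {a, (a + 1) mod 5, (a + 2) mod 5}" "a \<in> {b, (b + 1) mod 5, (b + 2) mod 5}"
  shows "a = b"
proof -
  from assms(1) consider "a = 0" | "a = 1" | "a = 2" | "a = 3" | "a = 4" by blast
  then show ?thesis by cases (use assms(2,3) in auto)
qed


section \<open>Rhombi and the tile across a side\<close>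

text \<open>A tile is only a set; the parameters add a base corner and the two sides that start there.\<close>

definition par :: "complex \<Rightarrow> complex \<Rightarrow> complex \<Rightarrow> complex set" where
  "par u p q = convex hull {u, u + p, u + q, u + p + q}"

text \<open>Sides of equal length in different directions; by Cauchy and Schwarz the second condition says
  that the sides are not parallel.\<close>

definition rhombic :: "complex \<Rightarrow> complex \<Rightarrow> bool" where
  "rhombic p q \<longleftrightarrow> norm p = norm q \<and> \<bar>p \<bullet> q\<bar> < norm p ^ 2"

lemma rhombic_zeta5: "r < 5 \<Longrightarrow> s < 5 \<Longrightarrow> r \<noteq> s \<Longrightarrow> rhombic (zeta5 ^ r) (zeta5 ^ s)"
  unfolding rhombic_def norm_zeta5_power using abs_inner_zeta5_powers[of r s] by simp

lemma rhombic_swap: "rhombic p q \<Longrightarrow> rhombic q p"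
  unfolding rhombic_def by (metis inner_commute)

lemma rhombic_minus: "rhombic p (- q) \<longleftrightarrow> rhombic p q"
  by (simp add: rhombic_def)

lemma par_swap: "par u p q = par u q p"
  unfolding par_def by (rule arg_cong[where f="\<lambda>S. convex hull S"]) (auto simp: algebra_simps)

lemma par_flip: "par (u + q) p (- q) = par u p q"
  unfolding par_def by (rule arg_cong[where f="\<lambda>S. convex hull S"]) (auto simp: algebra_simps)

lemma par_translation: "(+) t ` par u p q = par (t + u) p q"
  unfolding par_def convex_hull_translation[symmetric] by (simp add: algebra_simps)

lemma compact_par: "compact (par u p q)"
  unfolding par_def by (simp add: finite_imp_compact_convex_hull)

lemma vertices_subset_par: "{u, u + p, u + q, u + p + q} \<subseteq> par u p q"
  unfolding par_def by (rule hull_subset)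

lemma par_bound:
  assumes "x \<in> par u p q" shows "dist u x \<le> norm p + norm q"
proof -
  have "par u p q \<subseteq> cball u (norm p + norm q)"
    unfolding par_def
    by (rule hull_minimal) (auto simp: dist_norm norm_minus_commute add.assoc norm_triangle_ineq
        norm_triangle_ineq[of q p, simplified add.commute[of "norm q"]] simp flip: minus_add_distrib)
  then show ?thesis using assms by auto
qed

lemma par_halfspace:
  assumes "\<And>v. v \<in> {u, u + p, u + q, u + p + q} \<Longrightarrow> c \<le> n \<bullet> v" "x \<in> par u p q"
  shows "c \<le> n \<bullet> x"
proof -
  have "par u p q \<subseteq> {x. c \<le> n \<bullet> x}"
    unfolding par_def
    by (rule hull_minimal) (use assms(1) convex_halfspace_ge[of c n] in auto)
  then show ?thesis using assms(2) by auto
qed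

text \<open>The diagonal from the base corner is a direction in which this corner is strictly lowest.\<close>

lemma rhombic_bisector:
  assumes "rhombic p q" shows "0 < (p + q) \<bullet> p" "0 < (p + q) \<bullet> q"
  using assms unfolding rhombic_def by (auto simp: inner_simps dot_square_norm inner_commute)

lemma extreme_point_par_base:
  assumes "rhombic p q"
  shows "u extreme_point_of par u p q"
proof -
  define n where "n = p + q"
  define k where "k = min (n \<bullet> p) (n \<bullet> q)"
  have n: "0 < n \<bullet> p" "0 < n \<bullet> q" using rhombic_bisector[OF assms] by (simp_all add: n_def)
  have "convex hull {u + p, u + q, u + p + q} \<subseteq> {x. n \<bullet> u + k \<le> n \<bullet> x}"
    by (rule hull_minimal)
      (use n convex_halfspace_ge[of "n \<bullet> u + k" n] in \<open>auto simp: k_def inner_add_right\<close>)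
  moreover have "\<not> n \<bullet> u + k \<le> n \<bullet> u" using n by (auto simp: k_def)
  ultimately have "u \<notin> convex hull {u + p, u + q, u + p + q}" by blast
  then show ?thesis
    unfolding par_def by (intro extreme_point_of_convex_hull_insert) auto
qed

lemma extreme_point_par:
  assumes "rhombic p q"
  shows "x extreme_point_of par u p q \<longleftrightarrow> x \<in> {u, u + p, u + q, u + p + q}"
proof
  assume "x extreme_point_of par u p q"
  then show "x \<in> {u, u + p, u + q, u + p + q}"
    unfolding par_def by (rule extreme_point_of_convex_hull)
next
  have 1: "(u + q) extreme_point_of par u p q" if "rhombic p q" for u p q
    using extreme_point_par_base[of p "- q" "u + q"] that by (simp add: par_flip rhombic_minus)
  have 2: "(u + p) extreme_point_of par u p q"
    using 1[of q p u] assms by (simp add: par_swap rhombic_swap)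
  have "(u + q + p) extreme_point_of par (u + q) p (- q)"
    using 1[of "- q" p "u + q"] assms by (simp add: par_swap[of _ p] rhombic_swap rhombic_minus)
  then have 3: "(u + p + q) extreme_point_of par u p q" unfolding par_flip by (simp add: ac_simps)
  assume "x \<in> {u, u + p, u + q, u + p + q}"
  then show "x extreme_point_of par u p q"
    using extreme_point_par_base[OF assms] 1[OF assms] 2 3 by auto
qed

lemma par_vertices_eq:
  assumes "rhombic p q" "rhombic p' q'" "par u p q = par u' p' q'"
  shows "{u, u + p, u + q, u + p + q} = {u', u' + p', u' + q', u' + p' + q'}"
  using extreme_point_par[OF assms(1), of _ u] extreme_point_par[OF assms(2), of _ u']
  unfolding assms(3) by blast

lemma par_base_inj:
  assumes "rhombic p q" "par u p q = par u' p q"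
  shows "u = u'"
proof -
  have *: "u = u' \<or> (p + q) \<bullet> u' < (p + q) \<bullet> u" if "par u p q = par u' p q" for u u'
  proof -
    have "u \<in> {u', u' + p, u' + q, u' + p + q}"
      using par_vertices_eq[OF assms(1) assms(1) that] by blast
    then show ?thesis
      using rhombic_bisector[OF assms(1)] by (auto simp: inner_add_right)
  qed
  show ?thesis using *[of u u'] *[of u' u] assms(2) by auto
qed

text \<open>A convex set without interior lies in a hyperplane.  The normal vector would be orthogonal to
  both sides, which are linearly independent.\<close>

lemma interior_par_nonempty:
  assumes "rhombic p q"
  shows "interior (par u p q) \<noteq> {}"
proof
  assume "interior (par u p q) = {}"
  then obtain a b where a: "a \<noteq> 0" "par u p q \<subseteq> {x. a \<bullet> x = b}"
    using empty_interior_subset_hyperplane[of "par u p q"] unfolding par_def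
    by (metis convex_convex_hull)
  then have "a \<bullet> u = b" "a \<bullet> (u + p) = b" "a \<bullet> (u + q) = b"
    using vertices_subset_par[of u p q] by auto
  then have *: "a \<bullet> p = 0" "a \<bullet> q = 0" by (simp_all add: inner_add_right)
  define d where "d = Re p * Im q - Im p * Re q"
  have "Re a * d = (a \<bullet> p) * Im q - (a \<bullet> q) * Im p" "Im a * d = (a \<bullet> q) * Re p - (a \<bullet> p) * Re q"
    by (simp_all add: d_def inner_complex_def algebra_simps)
  then have "d = 0" using * a(1) by (auto simp: complex_eq_iff)
  \<comment> \<open>the identity of Lagrange, which makes the vanishing of the determinant contradict rhombicity\<close>
  moreover have "(p \<bullet> q)^2 + d^2 = norm p ^ 2 * norm q ^ 2"
    unfolding d_def cmod_power2 inner_complex_def by (simp add: algebra_simps power2_eq_square)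
  ultimately have "(p \<bullet> q)^2 = (norm p ^ 2)^2"
    using assms unfolding rhombic_def by (simp add: power2_eq_square)
  then have "\<bar>p \<bullet> q\<bar> = norm p ^ 2" by (metis power2_eq_iff_nonneg
      abs_ge_zero power2_abs zero_le_power2)
  then show False using assms unfolding rhombic_def by linarith
qed

lemma midpoint_in_closure_outside:
  assumes "rhombic p q"
  shows "u + p /\<^sub>R 2 \<in> closure (- par u p q)"
proof -
  \<comment> \<open>a normal of the side \<open>p\<close> that points into the rhombus\<close>
  define n where "n = (p \<bullet> p) *\<^sub>R q - (p \<bullet> q) *\<^sub>R p"
  have np: "n \<bullet> p = 0" unfolding n_def inner_diff_left inner_scaleR_left inner_commute[of q p] by simp
  have "(p \<bullet> q)^2 < (norm p ^ 2)^2"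
    using assms unfolding rhombic_def by (metis abs_le_square_iff abs_norm_cancel
        linorder_not_le power2_abs abs_power2)
  moreover have "n \<bullet> q = norm p ^ 2 * norm q ^ 2 - (p \<bullet> q)^2"
    unfolding n_def inner_diff_left inner_scaleR_left dot_square_norm power2_eq_square ..
  moreover have "norm p = norm q" using assms by (simp add: rhombic_def)
  ultimately have nq: "0 < n \<bullet> q" by (simp add: power2_eq_square)
  have "u + p /\<^sub>R 2 - e *\<^sub>R q \<notin> par u p q" if "0 < e" for e
  proof
    assume "u + p /\<^sub>R 2 - e *\<^sub>R q \<in> par u p q"
    then have "n \<bullet> u \<le> n \<bullet> (u + p /\<^sub>R 2 - e *\<^sub>R q)"
      by (rule par_halfspace[rotated]) (use np nq in \<open>auto simp: inner_add_right\<close>)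
    then show False using np nq that
      by (simp add: inner_add_right inner_diff_right mult_le_0_iff)
  qed
  then have "\<forall>\<^sub>F e in at_right 0. u + p /\<^sub>R 2 - e *\<^sub>R q \<in> closure (- par u p q)"
    using closure_subset[of "- par u p q"]
    by (intro eventually_mono[OF eventually_at_right_less[of 0]]) blast
  moreover have "((\<lambda>e. u + p /\<^sub>R 2 - e *\<^sub>R q) \<longlongrightarrow> u + p /\<^sub>R 2 - 0 *\<^sub>R q) (at_right 0)"
    by (intro tendsto_intros)
  ultimately show ?thesis
    using Lim_in_closed_set[of "closure (- par u p q)"] by fastforce
qed

text \<open>The base corners of translates of one rhombus with disjoint interiors cannot be closer to each
  other than the radius of a disc inside the rhombus.\<close>

lemma finite_translates_near:
  assumes "rhombic p q" and disj: "\<And>R S. R \<in> T \<Longrightarrow> S \<in> T \<Longrightarrow> R \<noteq> S \<Longrightarrow> interior R \<inter> interior S = {}"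
  shows "finite {u. par u p q \<in> T \<and> par u p q \<inter> cball m e \<noteq> {}}" (is "finite ?U")
proof -
  have "bounded ?U"
  proof -
    have "dist m u \<le> e + (norm p + norm q)" if "u \<in> ?U" for u
    proof -
      from that obtain x where "x \<in> par u p q" "dist m x \<le> e" by auto
      then show ?thesis using par_bound[of x u p q] dist_triangle2[of m u x] by simp
    qed
    then show ?thesis unfolding bounded_def by blast
  qed
  moreover have "uniform_discrete ?U"
  proof -
    obtain x where "x \<in> interior (par 0 p q)" using interior_par_nonempty[OF assms(1)] by blast
    then obtain d where d: "0 < d" "ball x d \<subseteq> interior (par 0 p q)"
      by (meson open_contains_ball open_interior)
    have int: "interior (par u p q) = (+) u ` interior (par 0 p q)" for u
      using interior_translation[of u "par 0 p q"] by (simp add: par_translation)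
    have "u = v" if "u \<in> ?U" "v \<in> ?U" "dist u v < d" for u v
    proof -
      have "dist x (x + (u - v)) = dist u v" by (simp add: dist_norm norm_minus_commute)
      then have "x + (u - v) \<in> ball x d" using that(3) unfolding mem_ball by (rule ord_eq_less_trans)
      then have "x + (u - v) \<in> interior (par 0 p q)" by (rule subsetD[OF d(2)])
      moreover have "x \<in> interior (par 0 p q)" using subsetD[OF d(2), of x] d(1) by simp
      ultimately have "u + x \<in> interior (par u p q)" "v + (x + (u - v)) \<in> interior (par v p q)"
        unfolding int[of u] int[of v] by (blast intro: imageI)+
      moreover have "v + (x + (u - v)) = u + x" by simp
      ultimately have "interior (par u p q) \<inter> interior (par v p q) \<noteq> {}" by (metis disjoint_iff)
      then have "par u p q = par v p q" using disj that(1,2) by blast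
      then show ?thesis by (rule par_base_inj[OF assms(1)])
    qed
    then show ?thesis unfolding uniform_discrete_def using d(1) by blast
  qed
  ultimately show ?thesis using uniform_discrete_finite_iff by blast
qed

text \<open>Only finitely many tiles come near the midpoint of a side, and they are closed; so one of
  those covering the points beyond the side contains the midpoint.  Being a common face, its
  intersection with the given tile then contains the whole side.\<close>

lemma tile_across_side:
  assumes cover: "\<Union>T = UNIV"
    and disj: "\<And>R S. R \<in> T \<Longrightarrow> S \<in> T \<Longrightarrow> R \<noteq> S \<Longrightarrow>
      interior R \<inter> interior S = {} \<and> (R \<inter> S) face_of R \<and> (R \<inter> S) face_of S"
    and shapes: "\<And>R. R \<in> T \<Longrightarrow> \<exists>u p q. (p, q) \<in> D \<and> R = par u p q"
    and D: "finite D" "\<And>p q. (p, q) \<in> D \<Longrightarrow> rhombic p q"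
    and R: "par u p q \<in> T" "rhombic p q"
  shows "\<exists>S\<in>T. S \<noteq> par u p q \<and> u extreme_point_of S \<and> (u + p) extreme_point_of S"
proof -
  define R where "R = par u p q"
  define m where "m = u + p /\<^sub>R 2"
  define F where "F = {S \<in> T. S \<noteq> R \<and> S \<inter> cball m 1 \<noteq> {}}"
  have "F \<subseteq> (\<Union>(p,q)\<in>D. (\<lambda>u. par u p q) ` {u. par u p q \<in> T \<and> par u p q \<inter> cball m 1 \<noteq> {}})"
    using shapes unfolding F_def by fastforce
  moreover have "finite (\<Union>(p,q)\<in>D. (\<lambda>u. par u p q) `
      {u. par u p q \<in> T \<and> par u p q \<inter> cball m 1 \<noteq> {}})"
    using finite_translates_near[where T=T and m=m and e=1] D disj by auto
  ultimately have "finite F" by (rule finite_subset)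
  moreover have "closed S" if "S \<in> F" for S
    using that shapes compact_imp_closed[OF compact_par] unfolding F_def by blast
  ultimately have cl: "closed (\<Union>F)" by auto
  have "ball m 1 \<inter> - R \<subseteq> \<Union>F"
  proof
    fix x assume x: "x \<in> ball m 1 \<inter> - R"
    obtain S where "S \<in> T" "x \<in> S" using cover by blast
    moreover have "x \<in> cball m 1" using x by simp
    ultimately have "S \<in> F" using x unfolding F_def by blast
    then show "x \<in> \<Union>F" using \<open>x \<in> S\<close> by blast
  qed
  then have "closure (ball m 1 \<inter> - R) \<subseteq> \<Union>F" using cl by (rule closure_minimal)
  moreover have "m \<in> ball m 1 \<inter> closure (- R)"
    using midpoint_in_closure_outside[OF R(2), of u] unfolding m_def R_def by simp
  ultimately have "m \<in> \<Union>F" using open_Int_closure_subset[of "ball m 1" "- R"] by blast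
  then obtain S where S: "S \<in> T" "S \<noteq> R" "m \<in> S" unfolding F_def by blast
  have faces: "(R \<inter> S) face_of R" "(R \<inter> S) face_of S"
    using disj[of R S] R S unfolding R_def by auto
  have "p \<noteq> 0" using R(2) unfolding rhombic_def by auto
  then have seg: "m \<in> open_segment u (u + p)"
    unfolding in_segment m_def
    by (intro conjI exI[of _ "1/2"]) (auto simp: scaleR_conv_of_real field_simps)
  have ends: "u extreme_point_of R" "(u + p) extreme_point_of R"
    using extreme_point_par[OF R(2), of _ u] unfolding R_def by auto
  then have inR: "u \<in> R" "u + p \<in> R" unfolding extreme_point_of_def by auto
  then have "m \<in> R"
    using seg convex_contains_open_segment[of R] convex_convex_hull unfolding R_def par_def by blast
  then have "u \<in> R \<inter> S \<and> u + p \<in> R \<inter> S"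
    using face_ofD[OF faces(1) seg] inR S(3) by blast
  then have "u extreme_point_of S \<and> (u + p) extreme_point_of S"
    using extreme_point_of_face[OF faces(1)] extreme_point_of_face[OF faces(2)] ends by blast
  then show ?thesis using S unfolding R_def by blast
qed


section \<open>Crossings of a regular pentagrid\<close>

definition grid_coord :: "(nat \<Rightarrow> real) \<Rightarrow> nat \<Rightarrow> complex \<Rightarrow> real" where
  "grid_coord \<gamma> j z = Re (z / zeta5 ^ j) + \<gamma> j"

definition crossing :: "(nat \<Rightarrow> real) \<Rightarrow> nat \<Rightarrow> nat \<Rightarrow> complex \<Rightarrow> bool" where
  "crossing \<gamma> r s z \<longleftrightarrow>
     r < 5 \<and> s < 5 \<and> r \<noteq> s \<and> grid_coord \<gamma> r z \<in> \<int> \<and> grid_coord \<gamma> s z \<in> \<int>"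

text \<open>The defect of family \<open>j\<close>, which vanishes exactly on its grid lines.  The defects of all families
  add up to the index of the corner that belongs to \<open>z\<close>.\<close>

definition overshoot :: "(nat \<Rightarrow> real) \<Rightarrow> nat \<Rightarrow> complex \<Rightarrow> real" where
  "overshoot \<gamma> j z = of_int (grid_index \<gamma> j z) - grid_coord \<gamma> j z"

lemma grid_line_iff: "z \<in> grid_line \<gamma> j k \<longleftrightarrow> grid_coord \<gamma> j z = of_int k"
  by (simp add: grid_line_def grid_coord_def)

lemma grid_index_eq: "grid_index \<gamma> j z = \<lceil>grid_coord \<gamma> j z\<rceil>"
  by (simp add: grid_index_def grid_coord_def)

lemma overshoot_bounds: "0 \<le> overshoot \<gamma> j z" "overshoot \<gamma> j z < 1"
  unfolding overshoot_def grid_index_eq by linarith+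

lemma overshoot_zero_iff: "overshoot \<gamma> j z = 0 \<longleftrightarrow> grid_coord \<gamma> j z \<in> \<int>"
  unfolding overshoot_def grid_index_eq
  by (metis Ints_of_int ceiling_of_int eq_iff_diff_eq_0 Ints_cases)

lemma divide_zeta5_power: "z / zeta5 ^ j = z * cnj (zeta5 ^ j)"
  using norm_zeta5_power[of j] complex_div_cnj[of z "zeta5 ^ j"] by simp

lemma crossing_commute: "crossing \<gamma> r s z \<Longrightarrow> crossing \<gamma> s r z"
  by (auto simp: crossing_def)

text \<open>Regularity speaks of distinct lines, so lines of different families must be seen to be
  different sets; they have different directions.\<close>

lemma grid_lines_of_two_families_distinct:
  assumes "r < 5" "s < 5" "r \<noteq> s"
  shows "grid_line \<gamma> r k \<noteq> grid_line \<gamma> s m"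
proof
  assume eq: "grid_line \<gamma> r k = grid_line \<gamma> s m"
  define z where "z = of_real (of_int k - \<gamma> r) * zeta5 ^ r"
  define w where "w = \<i> * zeta5 ^ r"
  have "z \<in> grid_line \<gamma> r k" "z + w \<in> grid_line \<gamma> r k"
    unfolding grid_line_def z_def w_def
    using zeta5_power_nonzero[of 1] by (simp_all add: add_divide_distrib)
  then have "z \<in> grid_line \<gamma> s m" "z + w \<in> grid_line \<gamma> s m" using eq by simp_all
  then have "Re (w / zeta5 ^ s) = 0" unfolding grid_line_def by (simp add: add_divide_distrib)
  then have "Im (zeta5 ^ r * cnj (zeta5 ^ s)) = 0"
    unfolding divide_zeta5_power w_def by (simp add: mult.assoc del: complex_cnj_power)
  moreover have "(Re (zeta5 ^ r * cnj (zeta5 ^ s)))^2 + (Im (zeta5 ^ r * cnj (zeta5 ^ s)))^2 = 1"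
    unfolding cmod_power2[symmetric] norm_mult complex_mod_cnj norm_zeta5_power by simp
  moreover have "Re (zeta5 ^ r * cnj (zeta5 ^ s)) = zeta5 ^ r \<bullet> zeta5 ^ s"
    unfolding inner_complex_def by (simp del: complex_cnj_power)
  ultimately have "(zeta5 ^ r \<bullet> zeta5 ^ s)^2 = 1" by simp
  then show False using abs_inner_zeta5_powers[OF assms] by (simp add: abs_square_eq_1)
qed

lemma crossing_only_two:
  assumes "regular_pentagrid \<gamma>" "crossing \<gamma> r s z" "j < 5" "j \<noteq> r" "j \<noteq> s"
  shows "grid_coord \<gamma> j z \<notin> \<int>"
proof
  assume "grid_coord \<gamma> j z \<in> \<int>"
  then obtain a b c where abc: "z \<in> grid_line \<gamma> r a" "z \<in> grid_line \<gamma> s b" "z \<in> grid_line \<gamma> j c"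
    using assms(2) unfolding crossing_def grid_line_iff by (metis Ints_cases)
  have rs: "r < 5" "s < 5" "r \<noteq> s" using assms(2) by (auto simp: crossing_def)
  have "grid_line \<gamma> r a \<in> pentagrid \<gamma>" "grid_line \<gamma> s b \<in> pentagrid \<gamma>"
    "grid_line \<gamma> j c \<in> pentagrid \<gamma>"
    using rs assms(3) unfolding pentagrid_def by blast+
  moreover have "grid_line \<gamma> r a \<noteq> grid_line \<gamma> s b" "grid_line \<gamma> r a \<noteq> grid_line \<gamma> j c"
    "grid_line \<gamma> s b \<noteq> grid_line \<gamma> j c"
    using grid_lines_of_two_families_distinct rs assms(3-5) by metis+
  moreover have "grid_line \<gamma> r a \<inter> grid_line \<gamma> s b \<inter> grid_line \<gamma> j c \<noteq> {}" using abc by blast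
  ultimately show False using assms(1) unfolding regular_pentagrid_def by blast
qed

lemma overshoot_crossing:
  assumes "regular_pentagrid \<gamma>" "crossing \<gamma> r s z"
  shows "overshoot \<gamma> r z = 0" "overshoot \<gamma> s z = 0"
    "j < 5 \<Longrightarrow> j \<noteq> r \<Longrightarrow> j \<noteq> s \<Longrightarrow> 0 < overshoot \<gamma> j z"
proof -
  show "overshoot \<gamma> r z = 0" "overshoot \<gamma> s z = 0"
    using assms(2) by (simp_all add: overshoot_zero_iff crossing_def)
  assume "j < 5" "j \<noteq> r" "j \<noteq> s"
  then show "0 < overshoot \<gamma> j z"
    using crossing_only_two[OF assms] overshoot_bounds(1)[of \<gamma> j z] overshoot_zero_iff[of \<gamma> j z]
    by force
qed

lemma sum_grid_coord:
  assumes "regular_pentagrid \<gamma>"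
  shows "(\<Sum>j<5. grid_coord \<gamma> j z) = 0"
proof -
  have "(\<Sum>j<5. grid_coord \<gamma> j z) = Re (z * cnj (\<Sum>j<5. zeta5 ^ j)) + (\<Sum>j<5. \<gamma> j)"
    unfolding grid_coord_def divide_zeta5_power sum.distrib cnj_sum sum_distrib_left Re_sum ..
  then show ?thesis using assms unfolding sum_zeta5_powers regular_pentagrid_def by simp
qed

lemma sum_overshoot:
  "regular_pentagrid \<gamma> \<Longrightarrow> (\<Sum>j<5. overshoot \<gamma> j z) = of_int (\<Sum>j<5. grid_index \<gamma> j z)"
  by (simp add: overshoot_def sum_subtractf sum_grid_coord)

lemma sum_rotate5:
  assumes "r < (5::nat)"
  shows "(\<Sum>j<5. f j) = f r + f ((r + 1) mod 5) + f ((r + 2) mod 5) + f ((r + 3) mod 5)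
    + (f ((r + 4) mod 5) :: 'a::comm_monoid_add)"
  using assms unfolding less_5_cases sum_5 by (elim disjE) (simp_all add: ac_simps flip: numeral_2_eq_2)

lemma rotate5_cases:
  assumes "r < (5::nat)" "j < 5"
  obtains "j = r" | "j = (r + 1) mod 5" | "j = (r + 2) mod 5" | "j = (r + 3) mod 5"
    | "j = (r + 4) mod 5"
  using assms unfolding less_5_cases by fastforce

lemma rotate5_distinct:
  assumes "r < (5::nat)"
  shows "distinct [r, (r + 1) mod 5, (r + 2) mod 5, (r + 3) mod 5, (r + 4) mod 5]"
  using assms unfolding less_5_cases by auto

text \<open>The coordinates sum to 0, so the index of the base corner is the sum of the three overshoots
  that are not forced to vanish, each strictly between 0 and 1.\<close>

lemma crossing_index_sum:
  assumes "regular_pentagrid \<gamma>" "crossing \<gamma> r s z"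
  shows "(\<Sum>j<5. grid_index \<gamma> j z) \<in> {1, 2}"
proof -
  have rs: "r < 5" "s < 5" "r \<noteq> s" using assms(2) by (auto simp: crossing_def)
  have fin: "finite ({..<5} - {r, s})" by simp
  have card: "card ({..<5} - {r, s}) = 3" using rs by (simp add: card_Diff_subset)
  then have ne: "{..<5} - {r, s} \<noteq> {}" by force
  have "(\<Sum>j<5. overshoot \<gamma> j z) = (\<Sum>j\<in>{..<5} - {r, s}. overshoot \<gamma> j z)"
    by (rule sum.mono_neutral_right) (use overshoot_crossing(1,2)[OF assms] in auto)
  moreover have "0 < (\<Sum>j\<in>{..<5} - {r, s}. overshoot \<gamma> j z)"
    by (rule sum_pos) (use fin ne overshoot_crossing(3)[OF assms] in auto)
  moreover have "(\<Sum>j\<in>{..<5} - {r, s}. overshoot \<gamma> j z) < (\<Sum>j\<in>{..<5} - {r, s}. 1)"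
    by (rule sum_strict_mono) (use fin ne overshoot_bounds(2) in auto)
  ultimately have "0 < real_of_int (\<Sum>j<5. grid_index \<gamma> j z)"
    "real_of_int (\<Sum>j<5. grid_index \<gamma> j z) < 3"
    using card by (simp_all del: of_int_sum flip: sum_overshoot[OF assms(1)])
  then have "0 < (\<Sum>j<5. grid_index \<gamma> j z)" "(\<Sum>j<5. grid_index \<gamma> j z) < 3" by linarith+
  then show ?thesis by auto
qed

section \<open>Neighbouring crossings on a grid line\<close>

text \<open>The changes of the coordinates along the line satisfy the recurrence
  \<open>\<delta>\<^bsub>i+2\<^esub> = \<tau> \<delta>\<^bsub>i+1\<^esub> - \<delta>\<^bsub>i\<^esub>\<close> with \<open>\<delta>\<^bsub>0\<^esub> = 0\<close>.\<close>

lemma grid_coord_along_line: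
  assumes "r < 5" "grid_coord \<gamma> r z = grid_coord \<gamma> r w"
  defines "\<delta> \<equiv> \<lambda>i. grid_coord \<gamma> ((r + i) mod 5) w - grid_coord \<gamma> ((r + i) mod 5) z"
  shows "\<delta> 2 = tau * \<delta> 1" "\<delta> 3 = - tau * \<delta> 1" "\<delta> 4 = - \<delta> 1"
proof -
  define H where "H n = Re ((w - z) * cnj (zeta5 ^ n))" for n
  have d: "\<delta> i = H (r + i)" for i
    unfolding \<delta>_def H_def grid_coord_def divide_zeta5_power zeta5_power_mod
    by (simp add: algebra_simps)
  have rec: "H (Suc (Suc n)) = tau * H (Suc n) - H n" for n
    unfolding H_def zeta5_power_Suc2
    by (simp add: algebra_simps del: complex_cnj_power power_Suc)
  have "H r = 0" using d[of 0] assms(1,2) unfolding \<delta>_def by simp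
  then show 2: "\<delta> 2 = tau * \<delta> 1" using rec[of r] by (simp add: d)
  have "\<delta> 3 = tau * \<delta> 2 - \<delta> 1" using rec[of "r + 1"] by (simp add: d numeral_eq_Suc)
  also have "\<dots> = (tau ^ 2 - 1) * \<delta> 1" unfolding 2 by (simp add: power2_eq_square algebra_simps)
  finally show 3: "\<delta> 3 = - tau * \<delta> 1" unfolding tau_square by simp
  have "\<delta> 4 = tau * \<delta> 3 - \<delta> 2" using rec[of "r + 2"] by (simp add: d numeral_eq_Suc)
  also have "\<dots> = - (tau ^ 2 + tau) * \<delta> 1" unfolding 2 3 by (simp add: power2_eq_square algebra_simps)
  finally show "\<delta> 4 = - \<delta> 1" unfolding tau_square by simp
qed

text \<open>Going along the line by \<open>d\<close>, one of the three quantities must reach 0.  If it is the first or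
  the last, the other of the two takes over their sum \<open>2 - a3 > 1\<close>.  If it is the middle one, then
  \<open>d = a3 / \<tau> > a3\<close>, and the first exceeds \<open>a1 + a3 = 2 - a4 > 1\<close>.\<close>

lemma thin_conflict_real:
  fixes a1 a3 a4 d :: real
  assumes "a3 < 1" "a4 < 1" "0 < a3" "a1 + a3 + a4 = 2"
    and "a1 + d < 1" "a4 - d < 1"
    and "a1 + d = 0 \<or> a3 - tau * d = 0 \<or> a4 - d = 0"
  shows False
proof -
  have "a3 < d" if "a3 = tau * d"
  proof -
    have "0 < d" using that assms(3) tau_pos by (metis zero_less_mult_pos)
    then show ?thesis using that tau_less_1 by simp
  qed
  then show False using assms by auto
qed

text \<open>The function \<open>a\<close> stands for the overshoots at the crossing of a thin tile, and \<open>b\<close> for those at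
  another crossing on the same line of family \<open>r\<close>; in the second application below both are replaced
  by their complements to 1.\<close>

lemma thin_conflict:
  fixes a b :: "nat \<Rightarrow> real"
  assumes r: "r < 5" and s': "s' < 5" "s' \<noteq> r" "s' \<noteq> (r + 2) mod 5"
    and sum: "(\<Sum>j\<in>{..<5} - {r}. a j) = 2"
    and a0: "a ((r + 2) mod 5) = 0"
    and a: "\<And>j. j < 5 \<Longrightarrow> j \<noteq> r \<Longrightarrow> j \<noteq> (r + 2) mod 5 \<Longrightarrow> 0 < a j \<and> a j < 1"
    and b0: "b s' = 0" and b: "\<And>j. j < 5 \<Longrightarrow> j \<noteq> r \<Longrightarrow> b j < 1"
    and d: "b ((r + 1) mod 5) = a ((r + 1) mod 5) + d" "b ((r + 2) mod 5) = a ((r + 2) mod 5) + tau * d"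
      "b ((r + 3) mod 5) = a ((r + 3) mod 5) - tau * d" "b ((r + 4) mod 5) = a ((r + 4) mod 5) - d"
  shows False
proof -
  have "(\<Sum>j<5. a j) = a r + 2" using r sum by (simp add: sum.remove[of _ r])
  then have s: "a ((r + 1) mod 5) + a ((r + 3) mod 5) + a ((r + 4) mod 5) = 2"
    unfolding sum_rotate5[OF r, of a] a0 by simp
  have 1: "(r + 1) mod 5 < 5" "(r + 3) mod 5 < 5" "(r + 4) mod 5 < 5" by simp_all
  show False
  proof (rule thin_conflict_real[OF _ _ _ s, of d])
    show "a ((r + 3) mod 5) < 1" "a ((r + 4) mod 5) < 1" "0 < a ((r + 3) mod 5)"
      using a rotate5_distinct[OF r] by auto
    show "a ((r + 1) mod 5) + d < 1" "a ((r + 4) mod 5) - d < 1"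
      unfolding d[symmetric] by (rule b; use rotate5_distinct[OF r] in auto)+
    show "a ((r + 1) mod 5) + d = 0 \<or> a ((r + 3) mod 5) - tau * d = 0 \<or> a ((r + 4) mod 5) - d = 0"
      unfolding d[symmetric] using b0 s' by (cases rule: rotate5_cases[OF r s'(1)]) auto
  qed
qed

lemma sum_remove5: "r < 5 \<Longrightarrow> (\<Sum>j\<in>{..<5::nat} - {r}. f j) = (\<Sum>j<5. f j) - (f r :: real)"
  by (simp add: sum_diff1)

text \<open>Neighbours across the side from the base corner in direction \<open>\<zeta>\<^sup>r\<close> have the same integer vector if
  their base indices agree.  The overshoots of the families other than \<open>r\<close> sum to the base index 2.\<close>

lemma no_thin_pair_lower:
  assumes reg: "regular_pentagrid \<gamma>"
    and z: "crossing \<gamma> r ((r + 2) mod 5) z" and w: "crossing \<gamma> r s' w" "s' \<noteq> (r + 2) mod 5"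
    and K: "\<And>j. j < 5 \<Longrightarrow> grid_index \<gamma> j w = grid_index \<gamma> j z"
    and sum: "(\<Sum>j<5. grid_index \<gamma> j z) = 2"
  shows False
proof -
  have r: "r < 5" and s': "s' < 5" "s' \<noteq> r" using w by (auto simp: crossing_def)
  note oz = overshoot_crossing[OF reg z] and ow = overshoot_crossing[OF reg w(1)]
  have "grid_coord \<gamma> r z = grid_coord \<gamma> r w"
    using oz(1) ow(1) K[OF r] unfolding overshoot_def by simp
  note along = grid_coord_along_line[OF r this]
  have diff: "overshoot \<gamma> j w = overshoot \<gamma> j z - (grid_coord \<gamma> j w - grid_coord \<gamma> j z)"
    if "j < 5" for j using K[OF that] unfolding overshoot_def by simp
  show False
  proof (rule thin_conflict[where a="\<lambda>j. overshoot \<gamma> j z" and b="\<lambda>j. overshoot \<gamma> j w", OF r s' w(2)])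
    show "(\<Sum>j\<in>{..<5} - {r}. overshoot \<gamma> j z) = 2"
      using sum unfolding sum_remove5[OF r] sum_overshoot[OF reg] oz(1) by simp
    let ?d = "- (grid_coord \<gamma> ((r + 1) mod 5) w - grid_coord \<gamma> ((r + 1) mod 5) z)"
    show "overshoot \<gamma> ((r + 1) mod 5) w = overshoot \<gamma> ((r + 1) mod 5) z + ?d"
      by (subst diff) simp_all
    show "overshoot \<gamma> ((r + 2) mod 5) w = overshoot \<gamma> ((r + 2) mod 5) z + tau * ?d"
      by (subst diff, simp, subst along) (simp add: algebra_simps)
    show "overshoot \<gamma> ((r + 3) mod 5) w = overshoot \<gamma> ((r + 3) mod 5) z - tau * ?d"
      by (subst diff, simp, subst along) (simp add: algebra_simps)
    show "overshoot \<gamma> ((r + 4) mod 5) w = overshoot \<gamma> ((r + 4) mod 5) z - ?d"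
      by (subst diff, simp, subst along) (simp add: algebra_simps)
    show "overshoot \<gamma> ((r + 2) mod 5) z = 0" "overshoot \<gamma> s' w = 0" by (rule oz(2), rule ow(2))
    show "0 < overshoot \<gamma> j z \<and> overshoot \<gamma> j z < 1"
      if "j < 5" "j \<noteq> r" "j \<noteq> (r + 2) mod 5" for j
      using oz(3)[OF that] overshoot_bounds(2) by simp
    show "overshoot \<gamma> j w < 1" for j by (rule overshoot_bounds)
  qed
qed

text \<open>Neighbours across the opposite side, from \<open>K + e\<^sub>s\<close>, when the base index is 1.  Reflection turns
  this into the lower case: the complements to 1 of the overshoots, counted from the vector of this
  side, again sum to 2 over the four families other than \<open>r\<close>.\<close>

lemma no_thin_pair_upper:
  assumes reg: "regular_pentagrid \<gamma>"
    and z: "crossing \<gamma> r ((r + 2) mod 5) z" and w: "crossing \<gamma> r s' w" "s' \<noteq> (r + 2) mod 5"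
    and K: "\<And>j. j < 5 \<Longrightarrow> grid_index \<gamma> j w + of_bool (j = s') =
      grid_index \<gamma> j z + of_bool (j = (r + 2) mod 5)"
    and sum: "(\<Sum>j<5. grid_index \<gamma> j z) = 1"
  shows False
proof -
  define s where "s = (r + 2) mod 5"
  have r: "r < 5" and s': "s' < 5" "s' \<noteq> r" and s: "s < 5" "s \<noteq> r"
    using w z by (auto simp: crossing_def s_def)
  note oz = overshoot_crossing[OF reg z] and ow = overshoot_crossing[OF reg w(1)]
  have "grid_index \<gamma> r w = grid_index \<gamma> r z"
    using K[OF r] s' s unfolding s_def by simp
  then have "grid_coord \<gamma> r z = grid_coord \<gamma> r w"
    using oz(1) ow(1) unfolding overshoot_def by simp
  note along = grid_coord_along_line[OF r this]
  define a where "a j = 1 - of_bool (j = s) - overshoot \<gamma> j z" for j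
  define b where "b j = 1 - of_bool (j = s') - overshoot \<gamma> j w" for j
  have diff: "b j = a j + (grid_coord \<gamma> j w - grid_coord \<gamma> j z)"
    if "j < 5" for j
  proof -
    have "real_of_int (grid_index \<gamma> j w + of_bool (j = s')) =
        real_of_int (grid_index \<gamma> j z + of_bool (j = s))"
      using K[OF that] unfolding s_def by simp
    then show ?thesis unfolding overshoot_def a_def b_def by simp
  qed
  show False
  proof (rule thin_conflict[where a=a and b=b, OF r s' w(2)])
    have "(\<Sum>j<5. a j) = 4 - (\<Sum>j<5. overshoot \<gamma> j z)"
      unfolding a_def using s(1) by (simp add: sum_subtractf of_bool_def)
    also have "\<dots> = 3" using sum unfolding sum_overshoot[OF reg] by simp
    finally show "(\<Sum>j\<in>{..<5} - {r}. a j) = 2"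
      unfolding sum_remove5[OF r] using oz(1) s(2) by (simp add: a_def)
    let ?d = "grid_coord \<gamma> ((r + 1) mod 5) w - grid_coord \<gamma> ((r + 1) mod 5) z"
    show "b ((r + 1) mod 5) = a ((r + 1) mod 5) + ?d" by (subst diff) simp_all
    show "b ((r + 2) mod 5) = a ((r + 2) mod 5) + tau * ?d"
      by (subst diff, simp, subst along) simp
    show "b ((r + 3) mod 5) = a ((r + 3) mod 5) - tau * ?d"
      by (subst diff, simp, subst along) simp
    show "b ((r + 4) mod 5) = a ((r + 4) mod 5) - ?d"
      by (subst diff, simp, subst along) simp
    show "a ((r + 2) mod 5) = 0" using oz(2) unfolding a_def s_def by simp
    show "b s' = 0" using ow(2) unfolding b_def by simp
    show "0 < a j \<and> a j < 1" if "j < 5" "j \<noteq> r" "j \<noteq> (r + 2) mod 5" for j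
      using oz(3)[OF that] overshoot_bounds(2)[of \<gamma> j z] that(3) unfolding a_def s_def by simp
    show "b j < 1" if "j < 5" "j \<noteq> r" for j
      using ow(3)[OF that] overshoot_bounds(1)[of \<gamma> j w] unfolding b_def by (cases "j = s'") auto
  qed
qed

text \<open>While the coordinate of family \<open>r + 1\<close> changes by 2, the one of family \<open>r + 2\<close> changes by
  \<open>2 \<tau> > 1\<close> and must pass an integer.\<close>

lemma no_long_thick_ribbon:
  assumes reg: "regular_pentagrid \<gamma>"
    and z: "crossing \<gamma> r ((r + 1) mod 5) z" and w: "crossing \<gamma> r ((r + 1) mod 5) w"
    and K: "grid_index \<gamma> r w = grid_index \<gamma> r z"
      "grid_index \<gamma> ((r + 1) mod 5) w = grid_index \<gamma> ((r + 1) mod 5) z - 2"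
      "grid_index \<gamma> ((r + 2) mod 5) w = grid_index \<gamma> ((r + 2) mod 5) z"
  shows False
proof -
  have r: "r < 5" using z by (auto simp: crossing_def)
  note oz = overshoot_crossing[OF reg z] and ow = overshoot_crossing[OF reg w]
  have "grid_coord \<gamma> r z = grid_coord \<gamma> r w"
    using oz(1) ow(1) K(1) unfolding overshoot_def by simp
  note along = grid_coord_along_line[OF r this]
  have "grid_coord \<gamma> ((r + 1) mod 5) w - grid_coord \<gamma> ((r + 1) mod 5) z = - 2"
    using oz(2) ow(2) K(2) unfolding overshoot_def by simp
  then have "overshoot \<gamma> ((r + 2) mod 5) w - overshoot \<gamma> ((r + 2) mod 5) z = 2 * tau"
    using along(1) K(3) unfolding overshoot_def by simp
  then show False
    using overshoot_bounds(1)[of \<gamma> "(r + 2) mod 5" z] overshoot_bounds(2)[of \<gamma> "(r + 2) mod 5" w]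
      tau_gt_half by linarith
qed


section \<open>Pentagrid tiles\<close>

lemma pentagrid_tileE:
  assumes "R \<in> pentagrid_tiling \<gamma>"
  obtains r s z where "crossing \<gamma> r s z"
    "R = par (lattice_point (\<lambda>j. grid_index \<gamma> j z)) (zeta5 ^ r) (zeta5 ^ s)"
proof -
  obtain r s z k m where "R = pentagrid_tile \<gamma> r s z" "r < 5" "s < 5" "r \<noteq> s"
    "z \<in> grid_line \<gamma> r k" "z \<in> grid_line \<gamma> s m"
    using assms unfolding pentagrid_tiling_def by blast
  then show thesis
    by (intro that[of r s z])
      (auto simp: crossing_def grid_line_iff pentagrid_tile_def par_def base_vertex_def
        lattice_point_def)
qed

text \<open>Modulo 5 the three consecutive corner indices still have a well-defined first one, which belongs
  to the base corner alone; the base corner determines the directions of the two sides.\<close>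

lemma par_zeta5_eq:
  assumes "r < 5" "s < 5" "r \<noteq> s" "r' < 5" "s' < 5" "r' \<noteq> s'" "u' \<in> lattice"
    and eq: "par u (zeta5 ^ r) (zeta5 ^ s) = par u' (zeta5 ^ r') (zeta5 ^ s')"
  shows "u = u' \<and> (r = r' \<and> s = s' \<or> r = s' \<and> s = r')"
proof -
  define V where "V = {u, u + zeta5 ^ r, u + zeta5 ^ s, u + zeta5 ^ r + zeta5 ^ s}"
  define V' where "V' = {u', u' + zeta5 ^ r', u' + zeta5 ^ s', u' + zeta5 ^ r' + zeta5 ^ s'}"
  have VV: "V = V'"
    unfolding V_def V'_def by (rule par_vertices_eq[OF _ _ eq]) (simp_all add: rhombic_zeta5 assms)
  have mem: "u' \<in> V" "u \<in> V'" "u + zeta5 ^ r \<in> V'" "u + zeta5 ^ s \<in> V'"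
    using VV unfolding V_def V'_def by blast+
  have u: "u \<in> lattice" using mem(2) assms unfolding V'_def
    by (auto simp: lattice_add lattice_zeta5)
  note iv = index_vertices[OF u assms(1,2)] index_vertices[OF u assms(2,1)]
  note iv' = index_vertices[OF assms(7,4,5)] index_vertices[OF assms(7,5,4)]
  have i1: "index u' \<in> {index u, (index u + 1) mod 5, (index u + 2) mod 5}"
    using mem(1) iv unfolding V_def by auto
  have *: "index x \<in> {index u', (index u' + 1) mod 5, (index u' + 2) mod 5}"
    if "x \<in> V'" for x
    using that iv' unfolding V'_def by auto
  have i: "index u = index u'"
    by (rule mod5_close[OF index_cases i1 *[OF mem(2)]])
  have n: "(index u' + 1) mod 5 \<noteq> index u'" "(index u' + 2) mod 5 \<noteq> index u'"
    "(index u' + 1) mod 5 \<noteq> (index u' + 2) mod 5"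
    using index_cases[of u'] by auto
  have uu: "u = u'" using mem(2) i iv' n unfolding V'_def by auto
  have "u + zeta5 ^ r \<in> {u' + zeta5 ^ r', u' + zeta5 ^ s'}"
    using mem(3) iv(1) iv' n unfolding V'_def i by auto
  then have 1: "r \<in> {r', s'}" using uu zeta5_power_inj assms by auto
  have "u + zeta5 ^ s \<in> {u' + zeta5 ^ r', u' + zeta5 ^ s'}"
    using mem(4) iv(5) iv' n unfolding V'_def i by auto
  then have "s \<in> {r', s'}" using uu zeta5_power_inj assms by auto
  then show ?thesis using 1 uu assms by auto
qed


section \<open>Indices in a Penrose tiling\<close>

text \<open>A tile that is moved into a pentagrid tiling keeps its base corner and its two directions, so
  its crossing belongs to the families that the directions name.\<close>

lemma crossing_of_tile:
  assumes "r < 5" "s < 5" "r \<noteq> s" "(+) t ` par u (zeta5 ^ r) (zeta5 ^ s) \<in> pentagrid_tiling \<gamma>"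
  shows "\<exists>z. crossing \<gamma> r s z \<and> t + u = lattice_point (\<lambda>j. grid_index \<gamma> j z)"
proof -
  obtain r' s' z where c: "crossing \<gamma> r' s' z" and
    "par (t + u) (zeta5 ^ r) (zeta5 ^ s) =
      par (lattice_point (\<lambda>j. grid_index \<gamma> j z)) (zeta5 ^ r') (zeta5 ^ s')"
    using assms(4) unfolding par_translation by (elim pentagrid_tileE)
  moreover have "r' < 5" "s' < 5" "r' \<noteq> s'" using c by (auto simp: crossing_def)
  ultimately have "t + u = lattice_point (\<lambda>j. grid_index \<gamma> j z)"
    "r = r' \<and> s = s' \<or> r = s' \<and> s = r'"
    using par_zeta5_eq[OF assms(1-3), of r' s'] by blast+
  then show ?thesis using c crossing_commute by blast
qed

lemma unit_penrose_patch:
  assumes "unit_penrose_tiling T" "P \<subseteq> T" "finite P"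
  obtains \<gamma> t where "regular_pentagrid \<gamma>" "\<forall>R\<in>P. (+) t ` R \<in> pentagrid_tiling \<gamma>"
  using assms unfolding unit_penrose_tiling_def by (metis image_subset_iff)

lemma penrose_tile_shape:
  assumes "unit_penrose_tiling T" "R \<in> T"
  obtains u r s where "r < 5" "s < 5" "r \<noteq> s" "R = par u (zeta5 ^ r) (zeta5 ^ s)"
proof -
  obtain \<gamma> t where "(+) t ` R \<in> pentagrid_tiling \<gamma>"
    using unit_penrose_patch[OF assms(1), of "{R}"] assms(2) by blast
  then obtain r s z where c: "crossing \<gamma> r s z"
    and R: "(+) t ` R = par (lattice_point (\<lambda>j. grid_index \<gamma> j z)) (zeta5 ^ r) (zeta5 ^ s)"
    by (rule pentagrid_tileE)
  have "R = (+) (- t) ` (+) t ` R" by (simp add: image_image)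
  then have "R = par (- t + lattice_point (\<lambda>j. grid_index \<gamma> j z)) (zeta5 ^ r) (zeta5 ^ s)"
    unfolding R par_translation .
  then show thesis using c by (intro that) (auto simp: crossing_def)
qed

lemma vertex_of_tile:
  assumes "r < 5" "s < 5" "r \<noteq> s" "par u (zeta5 ^ r) (zeta5 ^ s) \<in> T"
    "v \<in> {u, u + zeta5 ^ r, u + zeta5 ^ s, u + zeta5 ^ r + zeta5 ^ s}"
  shows "v \<in> tiling_vertices T"
  using assms extreme_point_par[OF rhombic_zeta5[OF assms(1-3)], of v u]
  unfolding tiling_vertices_def by blast

lemma pentagrid_vertex_index:
  assumes reg: "regular_pentagrid \<gamma>" and rs: "r < 5" "s < 5" "r \<noteq> s"
    and R: "(+) t ` par u (zeta5 ^ r) (zeta5 ^ s) \<in> pentagrid_tiling \<gamma>"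
    and v: "v \<in> {u, u + zeta5 ^ r, u + zeta5 ^ s, u + zeta5 ^ r + zeta5 ^ s}"
  shows "t + v \<in> lattice \<and> index (t + v) \<noteq> 0"
proof -
  obtain z where z: "crossing \<gamma> r s z" "t + u = lattice_point (\<lambda>j. grid_index \<gamma> j z)"
    using crossing_of_tile[OF rs R] by blast
  have l: "t + u \<in> lattice" unfolding z(2) by simp
  have i: "index (t + u) \<in> {1, 2}"
    unfolding z(2) index_lattice_point using crossing_index_sum[OF reg z(1)] by auto
  define x where "x = t + v"
  have "x \<in> {t + u, t + u + zeta5 ^ r, t + u + zeta5 ^ s, t + u + zeta5 ^ r + zeta5 ^ s}"
    using v by (auto simp: x_def add.assoc)
  then show ?thesis
    unfolding x_def[symmetric] using l i index_vertices[OF l rs(1,2)] index_vertices[OF l rs(2,1)]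
    by (elim insertE emptyE) simp_all
qed

text \<open>Moving a vertex \<open>v0\<close> to one of the integers 0 to 4 gives all possible normalisations.  If none of
  them worked, each would have a vertex that refutes it.  The tiles at these five vertices and at
  \<open>v0\<close> form a finite patch, and the translation that takes this patch into a pentagrid tiling agrees,
  as far as indices are concerned, with one of the five.\<close>

lemma index_normalisation:
  assumes "unit_penrose_tiling T"
  obtains t where "\<And>v. v \<in> tiling_vertices T \<Longrightarrow> t + v \<in> lattice \<and> index (t + v) \<noteq> 0"
proof -
  define good where "good t v \<longleftrightarrow> t + v \<in> lattice \<and> index (t + v) \<noteq> 0" for t v
  have tile: "\<exists>R\<in>T. v extreme_point_of R" if "v \<in> tiling_vertices T" for v
    using that by (auto simp: tiling_vertices_def)
  have "\<exists>t. \<forall>v\<in>tiling_vertices T. good t v"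
  proof (rule ccontr)
    assume none: "\<not> ?thesis"
    then obtain v0 where v0: "v0 \<in> tiling_vertices T" by blast
    obtain w where w: "w c \<in> tiling_vertices T" "\<not> good (of_int c - v0) (w c)" for c :: int
      using choice[of "\<lambda>c w. w \<in> tiling_vertices T \<and> \<not> good (of_int c - v0) w"] none
      by blast
    obtain R where R: "v \<in> tiling_vertices T \<Longrightarrow> R v \<in> T \<and> v extreme_point_of R v" for v
      using tile by metis
    define P where "P = insert (R v0) ((\<lambda>c. R (w c)) ` {0..<5})"
    have "R v0 \<in> T" "R (w c) \<in> T" for c using R[OF v0] R[OF w(1)] by blast+
    then have PT: "P \<subseteq> T" "finite P" unfolding P_def by auto
    obtain \<gamma> t where reg: "regular_pentagrid \<gamma>"
      and P: "\<forall>S\<in>P. (+) t ` S \<in> pentagrid_tiling \<gamma>"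
      by (rule unit_penrose_patch[OF assms PT])
    have good: "good t v" if "v \<in> tiling_vertices T" "(+) t ` R v \<in> pentagrid_tiling \<gamma>" for v
    proof -
      have RT: "R v \<in> T" "v extreme_point_of R v" using R[OF that(1)] by simp_all
      obtain u r s where rs: "r < 5" "s < 5" "r \<noteq> s" and Rv: "R v = par u (zeta5 ^ r) (zeta5 ^ s)"
        by (rule penrose_tile_shape[OF assms RT(1)])
      have "v \<in> {u, u + zeta5 ^ r, u + zeta5 ^ s, u + zeta5 ^ r + zeta5 ^ s}"
        using RT(2) unfolding Rv extreme_point_par[OF rhombic_zeta5[OF rs]] .
      then show ?thesis
        unfolding good_def by (rule pentagrid_vertex_index[OF reg rs that(2)[unfolded Rv]])
    qed
    have t0: "t + v0 \<in> lattice" using good[OF v0] P unfolding good_def P_def by simp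
    define c where "c = index (t + v0)"
    have c: "c \<in> {0..<5}" using index_range[of "t + v0"] by (simp add: c_def)
    then have gw: "good t (w c)" using good[OF w(1)] P unfolding P_def by simp
    define x where "x = of_int c - v0 + w c"
    have xt: "x + (t + v0) = of_int c + (t + w c)" by (simp add: x_def)
    have "x = of_int c + (t + w c) - (t + v0)" by (simp add: x_def)
    moreover have "t + w c \<in> lattice" using gw by (simp add: good_def)
    ultimately have x: "x \<in> lattice"
      using lattice_diff[OF lattice_add[OF lattice_of_int] t0] by metis
    have "(index x + c) mod 5 = (c + index (t + w c)) mod 5"
      using arg_cong[OF xt, of index] index_add[OF x t0] gw
        index_add[OF lattice_of_int, of "t + w c" c] index_of_int[of c] c
      unfolding good_def c_def[symmetric] by simp
    then have "index x mod 5 = index (t + w c) mod 5"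
      by (simp add: add.commute[of c] mod_eq_dvd_iff)
    then have "index x = index (t + w c)"
      using index_range[of x] index_range[of "t + w c"] by simp
    then have "good (of_int c - v0) (w c)"
      using gw x unfolding good_def x_def by simp
    then show False using w(2) by blast
  qed
  then show thesis using that unfolding good_def by blast
qed


section \<open>Tilings with a constant base index\<close>

text \<open>The situation if the normalised index misses one of the values 1 to 4: then every tile has the
  lower, or every tile has the upper of the two possible base indices.  It is stated for residues and
  for an arbitrary translation because a patch inside a pentagrid may carry another normalisation.\<close>

definition base_constant :: "complex set set \<Rightarrow> complex \<Rightarrow> int \<Rightarrow> bool" where
  "base_constant T t b \<longleftrightarrow>
     (\<forall>v\<in>tiling_vertices T. t + v \<in> lattice) \<and>
     (\<forall>u r s. r < 5 \<and> s < 5 \<and> r \<noteq> s \<and> par u (zeta5 ^ r) (zeta5 ^ s) \<in> T \<longrightarrow> index (t + u) = b)"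

lemma penrose_tile_across_side:
  assumes T: "unit_penrose_tiling T" and R: "par u p q \<in> T" "rhombic p q"
  obtains v r s where "r < 5" "s < 5" "r \<noteq> s" "par v (zeta5 ^ r) (zeta5 ^ s) \<in> T"
    "par v (zeta5 ^ r) (zeta5 ^ s) \<noteq> par u p q"
    "u \<in> {v, v + zeta5 ^ r, v + zeta5 ^ s, v + zeta5 ^ r + zeta5 ^ s}"
    "u + p \<in> {v, v + zeta5 ^ r, v + zeta5 ^ s, v + zeta5 ^ r + zeta5 ^ s}"
proof -
  define D where "D = (\<lambda>(r, s). (zeta5 ^ r, zeta5 ^ s)) ` {(r, s). r < 5 \<and> s < 5 \<and> r \<noteq> s}"
  have "finite {(r::nat, s::nat). r < 5 \<and> s < 5 \<and> r \<noteq> s}"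
    by (rule finite_subset[of _ "{..<5} \<times> {..<5}"]) auto
  then have D: "finite D" "\<And>p q. (p, q) \<in> D \<Longrightarrow> rhombic p q"
    unfolding D_def by (auto intro: rhombic_zeta5)
  have shapes: "\<exists>u p q. (p, q) \<in> D \<and> R = par u p q" if RT: "R \<in> T" for R
  proof -
    obtain u r s where rs: "r < 5" "s < 5" "r \<noteq> s" "R = par u (zeta5 ^ r) (zeta5 ^ s)"
      using penrose_tile_shape[OF T RT] .
    moreover from rs have "(zeta5 ^ r, zeta5 ^ s) \<in> D"
      unfolding D_def by (intro image_eqI[of _ _ "(r, s)"]) auto
    ultimately show ?thesis by blast
  qed
  have disj: "interior R \<inter> interior S = {} \<and> (R \<inter> S) face_of R \<and> (R \<inter> S) face_of S"
    if "R \<in> T" "S \<in> T" "R \<noteq> S" for R S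
    using T that unfolding unit_penrose_tiling_def rhombic_tiling_def by blast
  have "\<exists>S\<in>T. S \<noteq> par u p q \<and> u extreme_point_of S \<and> (u + p) extreme_point_of S"
    by (rule tile_across_side[OF _ disj shapes D R])
      (use T in \<open>auto simp: unit_penrose_tiling_def rhombic_tiling_def\<close>)
  then obtain S where S: "S \<in> T" "S \<noteq> par u p q" "u extreme_point_of S" "(u + p) extreme_point_of S"
    by blast
  obtain v r s where rs: "r < 5" "s < 5" "r \<noteq> s" and "S = par v (zeta5 ^ r) (zeta5 ^ s)"
    using penrose_tile_shape[OF T S(1)] .
  then show thesis
    using that[OF rs, of v] S extreme_point_par[OF rhombic_zeta5[OF rs], of _ v] by blast
qed

lemma vertex_with_index:
  assumes u: "u \<in> lattice" and rs: "r < 5" "s < 5"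
    and v: "v \<in> {u, u + zeta5 ^ r, u + zeta5 ^ s, u + zeta5 ^ r + zeta5 ^ s}"
  shows "index v = index u \<Longrightarrow> v = u"
    "index v = (index u + 1) mod 5 \<Longrightarrow> v = u + zeta5 ^ r \<or> v = u + zeta5 ^ s"
    "index v = (index u + 2) mod 5 \<Longrightarrow> v = u + zeta5 ^ r + zeta5 ^ s"
proof -
  have n: "(index u + 1) mod 5 \<noteq> index u" "(index u + 2) mod 5 \<noteq> index u"
    "(index u + 1) mod 5 \<noteq> (index u + 2) mod 5"
    using index_cases[of u] by auto
  note iv = index_vertices(1,2)[OF u rs] index_vertices(1,2)[OF u rs(2,1)]
  show "index v = index u \<Longrightarrow> v = u" using v iv n by auto
  show "index v = (index u + 1) mod 5 \<Longrightarrow> v = u + zeta5 ^ r \<or> v = u + zeta5 ^ s"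
    using v iv n by auto
  show "index v = (index u + 2) mod 5 \<Longrightarrow> v = u + zeta5 ^ r + zeta5 ^ s"
    using v iv n by auto
qed

lemma base_lattice:
  assumes "base_constant T t b" "r < 5" "s < 5" "r \<noteq> s" "par u (zeta5 ^ r) (zeta5 ^ s) \<in> T"
  shows "t + u \<in> lattice" "index (t + u) = b"
  using assms vertex_of_tile[OF assms(2-5), of u] unfolding base_constant_def by auto

text \<open>Both tiles have the same base index, so a common corner with this index is the base corner of
  both.\<close>

lemma neighbour_lower:
  assumes T: "unit_penrose_tiling T" and B: "base_constant T t b"
    and rs: "r < 5" "s < 5" "r \<noteq> s" and R: "par u (zeta5 ^ r) (zeta5 ^ s) \<in> T"
  obtains s' where "s' < 5" "s' \<noteq> r" "s' \<noteq> s" "par u (zeta5 ^ r) (zeta5 ^ s') \<in> T"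
proof -
  obtain v p q where pq: "p < 5" "q < 5" "p \<noteq> q" and S: "par v (zeta5 ^ p) (zeta5 ^ q) \<in> T"
    and ne: "par v (zeta5 ^ p) (zeta5 ^ q) \<noteq> par u (zeta5 ^ r) (zeta5 ^ s)"
    and mem: "u \<in> {v, v + zeta5 ^ p, v + zeta5 ^ q, v + zeta5 ^ p + zeta5 ^ q}"
      "u + zeta5 ^ r \<in> {v, v + zeta5 ^ p, v + zeta5 ^ q, v + zeta5 ^ p + zeta5 ^ q}"
    using penrose_tile_across_side[OF T R rhombic_zeta5[OF rs]] .
  note lu = base_lattice[OF B rs R] and lv = base_lattice[OF B pq S]
  have shift: "t + x \<in> {t + v, t + v + zeta5 ^ p, t + v + zeta5 ^ q, t + v + zeta5 ^ p + zeta5 ^ q}"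
    if "x \<in> {v, v + zeta5 ^ p, v + zeta5 ^ q, v + zeta5 ^ p + zeta5 ^ q}" for x
    using that by (auto simp: add.assoc)
  have uv: "u = v" using vertex_with_index(1)[OF lv(1) pq(1,2) shift[OF mem(1)]] lu lv by simp
  have "index (t + (u + zeta5 ^ r)) = (index (t + v) + 1) mod 5"
    using index_vertices(1)[OF lu(1) rs(1) rs(2)] uv by (simp add: add.assoc)
  then have "t + (u + zeta5 ^ r) = t + v + zeta5 ^ p \<or> t + (u + zeta5 ^ r) = t + v + zeta5 ^ q"
    by (rule vertex_with_index(2)[OF lv(1) pq(1,2) shift[OF mem(2)]])
  then have "zeta5 ^ r = zeta5 ^ p \<or> zeta5 ^ r = zeta5 ^ q" by (simp add: uv add.assoc)
  then have "r = p \<or> r = q"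
    using zeta5_power_inj[OF rs(1) pq(1)] zeta5_power_inj[OF rs(1) pq(2)] by blast
  then show thesis
  proof
    assume "r = p"
    then show thesis using that[of q] pq S ne uv by auto
  next
    assume "r = q"
    then show thesis using that[of p] pq S ne uv by (auto simp: par_swap[of _ "zeta5 ^ p"])
  qed
qed

text \<open>Now it is the top corner that the two tiles have in common, so their base corners differ.\<close>

lemma neighbour_upper:
  assumes T: "unit_penrose_tiling T" and B: "base_constant T t b"
    and rs: "r < 5" "s < 5" "r \<noteq> s" and R: "par u (zeta5 ^ r) (zeta5 ^ s) \<in> T"
  obtains u' s' where "s' < 5" "s' \<noteq> r" "s' \<noteq> s" "par u' (zeta5 ^ r) (zeta5 ^ s') \<in> T"
    "u' + zeta5 ^ s' = u + zeta5 ^ s"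
proof -
  have R': "par (u + zeta5 ^ s) (zeta5 ^ r) (- (zeta5 ^ s)) \<in> T" using R by (simp add: par_flip)
  have rh: "rhombic (zeta5 ^ r) (- (zeta5 ^ s))" using rhombic_zeta5[OF rs] by (simp add: rhombic_minus)
  obtain v p q where pq: "p < 5" "q < 5" "p \<noteq> q" and S: "par v (zeta5 ^ p) (zeta5 ^ q) \<in> T"
    and ne: "par v (zeta5 ^ p) (zeta5 ^ q) \<noteq> par (u + zeta5 ^ s) (zeta5 ^ r) (- (zeta5 ^ s))"
    and mem: "u + zeta5 ^ s \<in> {v, v + zeta5 ^ p, v + zeta5 ^ q, v + zeta5 ^ p + zeta5 ^ q}"
      "u + zeta5 ^ s + zeta5 ^ r \<in> {v, v + zeta5 ^ p, v + zeta5 ^ q, v + zeta5 ^ p + zeta5 ^ q}"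
    using penrose_tile_across_side[OF T R' rh] .
  note lu = base_lattice[OF B rs R] and lv = base_lattice[OF B pq S]
  have shift: "t + x \<in> {t + v, t + v + zeta5 ^ p, t + v + zeta5 ^ q, t + v + zeta5 ^ p + zeta5 ^ q}"
    if "x \<in> {v, v + zeta5 ^ p, v + zeta5 ^ q, v + zeta5 ^ p + zeta5 ^ q}" for x
    using that by (auto simp: add.assoc)
  have "index (t + (u + zeta5 ^ s + zeta5 ^ r)) = (index (t + v) + 2) mod 5"
    using index_vertices(2)[OF lu(1) rs(2,1)] lu lv by (simp add: add.assoc)
  then have "t + (u + zeta5 ^ s + zeta5 ^ r) = t + v + zeta5 ^ p + zeta5 ^ q"
    by (rule vertex_with_index(3)[OF lv(1) pq(1,2) shift[OF mem(2)]])
  then have top: "u + zeta5 ^ s + zeta5 ^ r = v + zeta5 ^ p + zeta5 ^ q" by (simp add: add.assoc)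
  have "index (t + (u + zeta5 ^ s)) = (index (t + v) + 1) mod 5"
    using index_vertices(1)[OF lu(1) rs(2,1)] lu lv by (simp add: add.assoc)
  then have "t + (u + zeta5 ^ s) = t + v + zeta5 ^ p \<or> t + (u + zeta5 ^ s) = t + v + zeta5 ^ q"
    by (rule vertex_with_index(2)[OF lv(1) pq(1,2) shift[OF mem(1)]])
  then consider "u + zeta5 ^ s = v + zeta5 ^ p" | "u + zeta5 ^ s = v + zeta5 ^ q"
    by (auto simp: add.assoc)
  then show thesis
  proof cases
    case 1
    then have "r = q" using top zeta5_power_inj[OF rs(1) pq(2)] by (simp add: add.assoc)
    moreover have "p \<noteq> s" using 1 ne \<open>r = q\<close> by (auto simp: par_flip par_swap[of _ "zeta5 ^ p"])
    ultimately show thesis using that[of p v] pq S 1 by (auto simp: par_swap[of _ "zeta5 ^ p"])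
  next
    case 2
    then have "r = p" using top zeta5_power_inj[OF rs(1) pq(1)] by (simp add: ac_simps)
    moreover have "q \<noteq> s" using 2 ne \<open>r = p\<close> by (auto simp: par_flip)
    ultimately show thesis using that[of q v] pq S 2 by auto
  qed
qed

text \<open>Inside one pentagrid, base indices are integers in \<open>{1, 2}\<close>, so equality modulo 5 is equality.\<close>

lemma common_index_sum:
  assumes T: "unit_penrose_tiling T" and B: "base_constant T t b" and P: "P \<subseteq> T" "finite P"
  obtains \<gamma> t' c where "regular_pentagrid \<gamma>"
    "\<forall>u r s. r < 5 \<longrightarrow> s < 5 \<longrightarrow> r \<noteq> s \<longrightarrow> par u (zeta5 ^ r) (zeta5 ^ s) \<in> P \<longrightarrow>
      (\<exists>z. crossing \<gamma> r s z \<and> t' + u = lattice_point (\<lambda>j. grid_index \<gamma> j z) \<and>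
        (\<Sum>j<5. grid_index \<gamma> j z) = c)"
proof -
  obtain \<gamma> t' where reg: "regular_pentagrid \<gamma>"
    and P': "\<forall>R\<in>P. (+) t' ` R \<in> pentagrid_tiling \<gamma>"
    by (rule unit_penrose_patch[OF T P])
  show thesis
  proof (rule that[OF reg, of t' "(b + index (t' - t)) mod 5"], intro allI impI)
    fix u r s
    assume rs: "r < 5" "s < 5" "r \<noteq> s" and R: "par u (zeta5 ^ r) (zeta5 ^ s) \<in> P"
    obtain z where z: "crossing \<gamma> r s z" "t' + u = lattice_point (\<lambda>j. grid_index \<gamma> j z)"
      using crossing_of_tile[OF rs P'[rule_format, OF R]] by blast
    have l: "t + u \<in> lattice" "index (t + u) = b" using base_lattice[OF B rs] R P(1) by blast+
    have "t' - t = (t' + u) - (t + u)" by simp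
    then have "t' - t \<in> lattice" using l(1) z(2) by (metis lattice_diff rangeI)
    then have "index ((t + u) + (t' - t)) = (b + index (t' - t)) mod 5"
      by (simp only: index_add[OF l(1)] l(2))
    moreover have "(t + u) + (t' - t) = t' + u" by simp
    ultimately have "(\<Sum>j<5. grid_index \<gamma> j z) mod 5 = (b + index (t' - t)) mod 5"
      using z(2) by (simp add: index_lattice_point)
    moreover have "(\<Sum>j<5. grid_index \<gamma> j z) mod 5 = (\<Sum>j<5. grid_index \<gamma> j z)"
      using crossing_index_sum[OF reg z(1)] by auto
    ultimately show "\<exists>z. crossing \<gamma> r s z \<and> t' + u = lattice_point (\<lambda>j. grid_index \<gamma> j z) \<and>
        (\<Sum>j<5. grid_index \<gamma> j z) = (b + index (t' - t)) mod 5"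
      using z by auto
  qed
qed

lemma lattice_point_add_unit:
  assumes "s < 5"
  shows "lattice_point (\<lambda>j. k j + m * of_bool (j = s)) = lattice_point k + of_int m * zeta5 ^ s"
    "(\<Sum>j<5. k j + m * of_bool (j = s)) = (\<Sum>j<5. k j) + m"
proof -
  have "lattice_point (\<lambda>j. m * of_bool (j = s)) = of_int m * lattice_point (\<lambda>j. of_bool (j = s))"
    unfolding lattice_point_def sum_distrib_left
    by (rule sum.cong) (simp_all add: mult.assoc)
  then show "lattice_point (\<lambda>j. k j + m * of_bool (j = s)) = lattice_point k + of_int m * zeta5 ^ s"
    using lattice_point_unit[OF assms] by (simp add: lattice_point_add)
  show "(\<Sum>j<5. k j + m * of_bool (j = s)) = (\<Sum>j<5. k j) + m"
    using assms by (simp add: sum.distrib of_bool_def flip: sum_distrib_left)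
qed

text \<open>Equations between points become equations between integer vectors, because both sides have the
  same coordinate sum.\<close>

lemma lattice_vector_exchange:
  assumes "lattice_point k + of_int m * zeta5 ^ r = lattice_point l + of_int m * zeta5 ^ s"
    and "(\<Sum>j<5. k j) = (\<Sum>j<5. l j)" "r < 5" "s < 5" "j < 5"
  shows "k j + m * of_bool (j = r) = l j + m * of_bool (j = s)"
proof (rule lattice_point_inj[where k="\<lambda>j. k j + m * of_bool (j = r)"
      and l="\<lambda>j. l j + m * of_bool (j = s)", OF _ _ assms(5)])
  show "lattice_point (\<lambda>j. k j + m * of_bool (j = r)) = lattice_point (\<lambda>j. l j + m * of_bool (j = s))"
    unfolding lattice_point_add_unit(1)[OF assms(3)] lattice_point_add_unit(1)[OF assms(4)]
    by (rule assms(1))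
  show "(\<Sum>j<5. k j + m * of_bool (j = r)) = (\<Sum>j<5. l j + m * of_bool (j = s))"
    unfolding lattice_point_add_unit(2)[OF assms(3)] lattice_point_add_unit(2)[OF assms(4)]
    by (simp add: assms(2))
qed

text \<open>Which of the two sides in direction \<open>\<zeta>\<^sup>r\<close> leads to the contradiction depends on the base index in
  the pentagrid, and the patch has to be chosen before this is known; so both neighbours are taken
  into it.\<close>

lemma base_constant_no_thin:
  assumes T: "unit_penrose_tiling T" and B: "base_constant T t b" and r: "r < 5"
    and R: "par u (zeta5 ^ r) (zeta5 ^ ((r + 2) mod 5)) \<in> T"
  shows False
proof -
  define s where "s = (r + 2) mod 5"
  have s: "s < 5" "r \<noteq> s" using rotate5_distinct[OF r] by (auto simp: s_def)
  note R = R[folded s_def]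
  obtain s1 where s1: "s1 < 5" "s1 \<noteq> r" "s1 \<noteq> s" "par u (zeta5 ^ r) (zeta5 ^ s1) \<in> T"
    using neighbour_lower[OF T B r s R] .
  obtain v s2 where s2: "s2 < 5" "s2 \<noteq> r" "s2 \<noteq> s" "par v (zeta5 ^ r) (zeta5 ^ s2) \<in> T"
    and v: "v + zeta5 ^ s2 = u + zeta5 ^ s"
    using neighbour_upper[OF T B r s R] .
  define P where "P = {par u (zeta5 ^ r) (zeta5 ^ s), par u (zeta5 ^ r) (zeta5 ^ s1),
    par v (zeta5 ^ r) (zeta5 ^ s2)}"
  have PT: "P \<subseteq> T" "finite P" using R s1(4) s2(4) by (simp_all add: P_def)
  obtain \<gamma> t' c where reg: "regular_pentagrid \<gamma>" and emb:
    "\<forall>u r s. r < 5 \<longrightarrow> s < 5 \<longrightarrow> r \<noteq> s \<longrightarrow> par u (zeta5 ^ r) (zeta5 ^ s) \<in> P \<longrightarrow>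
      (\<exists>z. crossing \<gamma> r s z \<and> t' + u = lattice_point (\<lambda>j. grid_index \<gamma> j z) \<and>
        (\<Sum>j<5. grid_index \<gamma> j z) = c)"
    by (rule common_index_sum[OF T B PT])
  obtain z where z: "crossing \<gamma> r s z" "t' + u = lattice_point (\<lambda>j. grid_index \<gamma> j z)"
    "(\<Sum>j<5. grid_index \<gamma> j z) = c"
    using emb[rule_format, OF r s, of u] unfolding P_def by blast
  obtain z1 where z1: "crossing \<gamma> r s1 z1" "t' + u = lattice_point (\<lambda>j. grid_index \<gamma> j z1)"
    "(\<Sum>j<5. grid_index \<gamma> j z1) = c"
    using emb[rule_format, OF r s1(1) s1(2)[symmetric], of u] unfolding P_def by blast
  obtain z2 where z2: "crossing \<gamma> r s2 z2" "t' + v = lattice_point (\<lambda>j. grid_index \<gamma> j z2)"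
    "(\<Sum>j<5. grid_index \<gamma> j z2) = c"
    using emb[rule_format, OF r s2(1) s2(2)[symmetric], of v] unfolding P_def by blast
  have "c = 1 \<or> c = 2" using crossing_index_sum[OF reg z(1)] z(3) by simp
  then show False
  proof
    assume c: "c = 2"
    have "grid_index \<gamma> j z1 = grid_index \<gamma> j z" if "j < 5" for j
      using lattice_point_inj[OF _ _ that, of "\<lambda>j. grid_index \<gamma> j z1" "\<lambda>j. grid_index \<gamma> j z"] z z1
      by simp
    then show False
      using no_thin_pair_lower[OF reg z(1)[unfolded s_def] z1(1) s1(3)[unfolded s_def]] z(3) c
      by blast
  next
    assume c: "c = 1"
    have "lattice_point (\<lambda>j. grid_index \<gamma> j z2) + of_int 1 * zeta5 ^ s2 =
        lattice_point (\<lambda>j. grid_index \<gamma> j z) + of_int 1 * zeta5 ^ s"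
      using v by (simp add: add.assoc flip: z(2) z2(2))
    then have "grid_index \<gamma> j z2 + 1 * of_bool (j = s2) = grid_index \<gamma> j z + 1 * of_bool (j = s)"
      if "j < 5" for j
      by (rule lattice_vector_exchange) (use z z2 s s2 that in simp_all)
    then show False
      using no_thin_pair_upper[OF reg z(1)[unfolded s_def] z2(1) s2(3)[unfolded s_def]] z(3) c
      unfolding s_def by simp
  qed
qed

text \<open>The relation between the two directions of a thin tile is \<open>s = r \<plusminus> 2\<close>, and exchanging them
  reduces it to one sign.\<close>

lemma base_constant_thick:
  assumes T: "unit_penrose_tiling T" and B: "base_constant T t b"
    and rs: "r < 5" "s < 5" "r \<noteq> s" and R: "par u (zeta5 ^ r) (zeta5 ^ s) \<in> T"
  shows "s = (r + 1) mod 5 \<or> s = (r + 4) mod 5"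
proof -
  have "s \<noteq> (r + 2) mod 5" using base_constant_no_thin[OF T B rs(1)] R by blast
  moreover have "r \<noteq> (s + 2) mod 5"
    using base_constant_no_thin[OF T B rs(2)] R by (metis par_swap)
  moreover have "(s + 2) mod 5 = r" if "s = (r + 3) mod 5"
    using that rs unfolding less_5_cases by auto
  ultimately show ?thesis using rs by (cases rule: rotate5_cases[OF rs(1,2)]) auto
qed

text \<open>Leaving a thick tile through its lower side one cannot meet family \<open>r + 1\<close> again, so the next tile
  has the side \<open>\<zeta>\<^sup>r\<^sup>+\<^sup>4\<close>; leaving that one through its upper side leads back to family \<open>r + 1\<close>.\<close>

lemma thick_ribbon_two_steps:
  assumes T: "unit_penrose_tiling T" and B: "base_constant T t b" and r: "r < 5"
    and R: "par u (zeta5 ^ r) (zeta5 ^ ((r + 1) mod 5)) \<in> T"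
  shows "par (u + zeta5 ^ ((r + 4) mod 5) - zeta5 ^ ((r + 1) mod 5)) (zeta5 ^ r)
    (zeta5 ^ ((r + 1) mod 5)) \<in> T"
proof -
  note dist = rotate5_distinct[OF r]
  have s: "(r + 1) mod 5 < 5" "r \<noteq> (r + 1) mod 5" "(r + 4) mod 5 < 5" "r \<noteq> (r + 4) mod 5"
    using dist by auto
  obtain s1 where "s1 < 5" "s1 \<noteq> r" "s1 \<noteq> (r + 1) mod 5" "par u (zeta5 ^ r) (zeta5 ^ s1) \<in> T"
    using neighbour_lower[OF T B r s(1,2) R] .
  then have R1: "par u (zeta5 ^ r) (zeta5 ^ ((r + 4) mod 5)) \<in> T"
    using base_constant_thick[OF T B r] by metis
  obtain v s2 where "s2 < 5" "s2 \<noteq> r" "s2 \<noteq> (r + 4) mod 5" "par v (zeta5 ^ r) (zeta5 ^ s2) \<in> T"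
    and v: "v + zeta5 ^ s2 = u + zeta5 ^ ((r + 4) mod 5)"
    using neighbour_upper[OF T B r s(3,4) R1] .
  moreover from this have "s2 = (r + 1) mod 5"
    using base_constant_thick[OF T B r] by metis
  ultimately show ?thesis by (metis add_diff_cancel_right')
qed

text \<open>Two double steps along a ribbon of thick tiles exchange \<open>2 e\<^bsub>r+1\<^esub>\<close> for \<open>2 e\<^bsub>r+4\<^esub>\<close> in the integer
  vector, without changing the entry of family \<open>r + 2\<close>.\<close>

lemma not_base_constant:
  assumes T: "unit_penrose_tiling T"
  shows "\<not> base_constant T t b"
proof
  assume B: "base_constant T t b"
  have "T \<noteq> {}" using T unfolding unit_penrose_tiling_def rhombic_tiling_def by auto
  then obtain u r where r: "r < 5" and R: "par u (zeta5 ^ r) (zeta5 ^ ((r + 1) mod 5)) \<in> T"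
  proof -
    assume *: "\<And>r u. r < 5 \<Longrightarrow> par u (zeta5 ^ r) (zeta5 ^ ((r + 1) mod 5)) \<in> T \<Longrightarrow> thesis"
    obtain R where "R \<in> T" using \<open>T \<noteq> {}\<close> by blast
    then obtain u r s where rs: "r < 5" "s < 5" "r \<noteq> s" and R: "par u (zeta5 ^ r) (zeta5 ^ s) \<in> T"
      using penrose_tile_shape[OF T] by metis
    have "r = (s + 1) mod 5" if "s = (r + 4) mod 5"
      using that rs unfolding less_5_cases by auto
    then show thesis
      using base_constant_thick[OF T B rs R] *[OF rs(1)] *[OF rs(2)] R by (metis par_swap)
  qed
  define s where "s = (r + 1) mod 5"
  define q where "q = (r + 4) mod 5"
  define v where "v = u + zeta5 ^ q - zeta5 ^ s + zeta5 ^ q - zeta5 ^ s"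
  note R = R[folded s_def]
  note dist = rotate5_distinct[OF r]
  have sq: "s < 5" "r \<noteq> s" "q < 5" using dist by (auto simp: s_def q_def)
  have R': "par v (zeta5 ^ r) (zeta5 ^ s) \<in> T"
    unfolding v_def using thick_ribbon_two_steps[OF T B r, folded s_def q_def] R by blast
  define P where "P = {par u (zeta5 ^ r) (zeta5 ^ s), par v (zeta5 ^ r) (zeta5 ^ s)}"
  have PT: "P \<subseteq> T" "finite P" using R R' by (simp_all add: P_def)
  obtain \<gamma> t' c where reg: "regular_pentagrid \<gamma>" and emb:
    "\<forall>u r s. r < 5 \<longrightarrow> s < 5 \<longrightarrow> r \<noteq> s \<longrightarrow> par u (zeta5 ^ r) (zeta5 ^ s) \<in> P \<longrightarrow>
      (\<exists>z. crossing \<gamma> r s z \<and> t' + u = lattice_point (\<lambda>j. grid_index \<gamma> j z) \<and>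
        (\<Sum>j<5. grid_index \<gamma> j z) = c)"
    by (rule common_index_sum[OF T B PT])
  obtain z where z: "crossing \<gamma> r s z" "t' + u = lattice_point (\<lambda>j. grid_index \<gamma> j z)"
    "(\<Sum>j<5. grid_index \<gamma> j z) = c"
    using emb[rule_format, OF r sq(1,2), of u] unfolding P_def by blast
  obtain w where w: "crossing \<gamma> r s w" "t' + v = lattice_point (\<lambda>j. grid_index \<gamma> j w)"
    "(\<Sum>j<5. grid_index \<gamma> j w) = c"
    using emb[rule_format, OF r sq(1,2), of v] unfolding P_def by blast
  have "lattice_point (\<lambda>j. grid_index \<gamma> j w) + of_int 2 * zeta5 ^ s =
      lattice_point (\<lambda>j. grid_index \<gamma> j z) + of_int 2 * zeta5 ^ q"
    unfolding z(2)[symmetric] w(2)[symmetric] v_def by simp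
  then have K: "grid_index \<gamma> j w + 2 * of_bool (j = s) = grid_index \<gamma> j z + 2 * of_bool (j = q)"
    if "j < 5" for j
    by (rule lattice_vector_exchange) (use z w sq that in simp_all)
  show False
    by (rule no_long_thick_ribbon[OF reg z(1)[unfolded s_def] w(1)[unfolded s_def]])
      (use K[of r] K[of s] K[of "(r + 2) mod 5"] dist r in \<open>auto simp: s_def q_def\<close>)
qed


section \<open>The index is a frieze pattern\<close>

lemma tile_indices:
  assumes t: "\<forall>v\<in>tiling_vertices T. t + v \<in> lattice \<and> index (t + v) \<noteq> 0"
    and rs: "r < 5" "s < 5" "r \<noteq> s" and R: "par u (zeta5 ^ r) (zeta5 ^ s) \<in> T"
  shows "index (t + u) \<in> {1, 2}" "index (t + (u + zeta5 ^ r)) = index (t + u) + 1"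
    "index (t + (u + zeta5 ^ s)) = index (t + u) + 1"
    "index (t + (u + zeta5 ^ r + zeta5 ^ s)) = index (t + u) + 2"
proof -
  note t = t[rule_format] and v = vertex_of_tile[OF rs R]
  have l: "t + u \<in> lattice" and n: "index (t + u) \<noteq> 0" using t[OF v[of u]] by auto
  note iv = index_vertices(1,2)[OF l rs(1,2)] index_vertices(1)[OF l rs(2,1)]
  have "index (t + (u + zeta5 ^ r)) \<noteq> 0" "index (t + (u + zeta5 ^ r + zeta5 ^ s)) \<noteq> 0"
    using t[OF v[of "u + zeta5 ^ r"]] t[OF v[of "u + zeta5 ^ r + zeta5 ^ s"]] by auto
  then have n': "(index (t + u) + 1) mod 5 \<noteq> 0" "(index (t + u) + 2) mod 5 \<noteq> 0"
    using iv by (simp_all add: add.assoc)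
  show i: "index (t + u) \<in> {1, 2}" using n n' index_cases[of "t + u"] by auto
  show "index (t + (u + zeta5 ^ r)) = index (t + u) + 1"
    "index (t + (u + zeta5 ^ s)) = index (t + u) + 1"
    "index (t + (u + zeta5 ^ r + zeta5 ^ s)) = index (t + u) + 2"
    using iv i by (auto simp: add.assoc)
qed

text \<open>For both shapes, the cosine of the angle at the first corner is one of the two values that
  inner products of distinct fifth roots of unity can take.\<close>

lemma rhombic_sides_of_tile:
  assumes "thick_rhombus l a b d c \<or> thin_rhombus l a b d c"
  shows "rhombic (b - a) (c - a)" "d = a + (b - a) + (c - a)" "norm (b - a) = l"
    "(b - a) \<bullet> (c - a) \<in> {l ^ 2 * (tau / 2), l ^ 2 * (- (1 + tau) / 2)}"
proof -
  have cos2: "cos (2 * pi / 5) = tau / 2" by (simp add: tau_def)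
  have "cos (4 * pi / 5) = cos (2 * (2 * pi / 5))" by simp
  also have "\<dots> = 2 * (tau / 2)^2 - 1" unfolding cos_double_cos cos2 ..
  also have "\<dots> = - (1 + tau) / 2" unfolding power_divide tau_square by (simp add: field_simps)
  finally have cos4: "cos (4 * pi / 5) = - (1 + tau) / 2" .
  obtain \<alpha> where \<alpha>: "rhombus l \<alpha> a b d c" "cos \<alpha> \<in> {tau / 2, - (1 + tau) / 2}"
    using assms cos2 cos4 unfolding thick_rhombus_def thin_rhombus_def by blast
  have l: "0 < l" "norm (b - a) = l" "norm (c - a) = l" "b - a = d - c"
    using \<alpha>(1) unfolding rhombus_def dist_norm norm_minus_commute[of a] by blast+
  show "norm (b - a) = l" by (rule l(2))
  show "d = a + (b - a) + (c - a)" using l(4) by (simp add: algebra_simps)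
  define x where "x = ((b - a) \<bullet> (c - a)) / (l * l)"
  have "\<bar>(b - a) \<bullet> (c - a)\<bar> \<le> l * l"
    using Cauchy_Schwarz_ineq2[of "b - a" "c - a"] l by simp
  then have "\<bar>x\<bar> \<le> 1" using l(1) unfolding x_def by simp
  moreover have "arccos x = \<alpha>"
    using \<alpha>(1) l unfolding rhombus_def angle_at_def x_def by simp
  ultimately have x: "x \<in> {tau / 2, - (1 + tau) / 2}" using \<alpha>(2) cos_arccos_abs[of x] by auto
  have "(b - a) \<bullet> (c - a) = l ^ 2 * x" using l(1) unfolding x_def by (simp add: power2_eq_square)
  then show "(b - a) \<bullet> (c - a) \<in> {l ^ 2 * (tau / 2), l ^ 2 * (- (1 + tau) / 2)}" using x by auto
  have "\<bar>x\<bar> < 1" using x tau_pos tau_less_1 by auto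
  then have "\<bar>(b - a) \<bullet> (c - a)\<bar> < l ^ 2"
    using l(1) unfolding x_def by (simp add: power2_eq_square)
  then show "rhombic (b - a) (c - a)" unfolding rhombic_def using l by simp
qed

lemma rhombic_distinct:
  assumes "rhombic p q"
  shows "distinct [u, u + p, u + q, u + p + q]"
proof -
  have "p \<noteq> 0" "q \<noteq> 0" "p \<noteq> q" "p + q \<noteq> 0"
    using assms rhombic_bisector[OF assms] unfolding rhombic_def
    by (auto simp: dot_square_norm)
  then show ?thesis by (auto simp: add.assoc)
qed

text \<open>The centre of the rhombus pairs opposite corners.  If the pairs were matched the wrong way, the
  angle at \<open>a\<close> would be the supplement of the angle between \<open>\<zeta>\<^sup>r\<close> and \<open>\<zeta>\<^sup>s\<close>; but the supplements of 72
  and 144 degrees are 108 and 36 degrees.\<close>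

lemma corners_of_tile:
  assumes rs: "r < 5" "s < 5" "r \<noteq> s"
    and hull: "convex hull {a, b, d, c} = par u (zeta5 ^ r) (zeta5 ^ s)"
    and shape: "thick_rhombus l a b d c \<or> thin_rhombus l a b d c"
  shows "{a, d} = {u, u + zeta5 ^ r + zeta5 ^ s}" "{b, c} = {u + zeta5 ^ r, u + zeta5 ^ s}"
proof -
  define p q where "p = zeta5 ^ r" and "q = zeta5 ^ s"
  define P Q where "P = b - a" and "Q = c - a"
  note sides = rhombic_sides_of_tile[OF shape, folded P_def Q_def]
  have b: "b = a + P" and c: "c = a + Q" and d: "d = a + P + Q" using sides(2) by (simp_all add: P_def Q_def)
  have pq: "rhombic p q" unfolding p_def q_def by (rule rhombic_zeta5[OF rs])
  have "{a, b, d, c} = {a, a + P, a + Q, a + P + Q}" using b c d by auto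
  then have "par a P Q = par u p q" using hull unfolding par_def p_def q_def by simp
  then have V: "{a, a + P, a + Q, a + P + Q} = {u, u + p, u + q, u + p + q}"
    by (rule par_vertices_eq[OF sides(1) pq])
  note D1 = rhombic_distinct[OF sides(1), of a] and D2 = rhombic_distinct[OF pq, of u]
  have "\<Sum>{a, a + P, a + Q, a + P + Q} = 4 * a + 2 * P + 2 * Q" using D1 by simp
  moreover have "\<Sum>{u, u + p, u + q, u + p + q} = 4 * u + 2 * p + 2 * q" using D2 by simp
  ultimately have "4 * a + 2 * P + 2 * Q = 4 * u + 2 * p + 2 * q" using V by simp
  then have "(4 * a + 2 * P + 2 * Q) / 2 = (4 * u + 2 * p + 2 * q) / 2" by simp
  then have centre: "2 * a + P + Q = 2 * u + p + q" by (simp add: add_divide_distrib)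
  have opp: "d = 2 * u + p + q - a" "c = 2 * u + p + q - b"
    unfolding centre[symmetric] by (simp_all add: b c d)
  have mem: "a \<in> {u, u + p, u + q, u + p + q}" "b \<in> {u, u + p, u + q, u + p + q}"
    using V b by blast+
  have ne: "b \<noteq> a" "b \<noteq> d" using D1 b d by auto
  have no: False if ad: "a = u + x" "d = u + y" and xy: "x = p \<and> y = q \<or> x = q \<and> y = p" for x y
  proof -
    have "b = u \<or> b = u + x + y" using mem(2) ne ad xy by auto
    then have "P = - x \<and> Q = y \<or> P = y \<and> Q = - x"
      unfolding P_def Q_def opp(2) ad(1) using xy by (auto simp: algebra_simps)
    then have "P \<bullet> Q = - (p \<bullet> q)" "norm P = 1"
      using xy by (auto simp: p_def q_def norm_zeta5_power inner_commute)
    then show False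
      using inner_zeta5_powers[OF rs, folded p_def q_def] sides(3,4) tau_pos by auto
  qed
  have "d = u + q" if "a = u + p" using that opp(1) by simp
  moreover have "d = u + p" if "a = u + q" using that opp(1) by simp
  ultimately have a: "a = u \<or> a = u + p + q" using mem(1) no by blast
  then have ad: "a = u \<and> d = u + p + q \<or> a = u + p + q \<and> d = u" using opp(1) by auto
  then show "{a, d} = {u, u + zeta5 ^ r + zeta5 ^ s}" unfolding p_def q_def by auto
  have "b = u + p \<or> b = u + q" using mem(2) ne ad by auto
  then have "b = u + p \<and> c = u + q \<or> b = u + q \<and> c = u + p" using opp(2) by auto
  then show "{b, c} = {u + zeta5 ^ r, u + zeta5 ^ s}" unfolding p_def q_def by auto
qed

lemma unit_penrose_frieze:
  assumes T: "unit_penrose_tiling T"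
  shows "\<exists>f :: complex \<Rightarrow> int. frieze_pattern T f \<and> card (f ` tiling_vertices T) = 4"
proof -
  obtain t where t: "\<forall>v\<in>tiling_vertices T. t + v \<in> lattice \<and> index (t + v) \<noteq> 0"
    using index_normalisation[OF T] by metis
  define f where "f v = index (t + v)" for v
  note ti = tile_indices[OF t, folded f_def]
  have "frieze_pattern T f"
    unfolding frieze_pattern_def
  proof (intro conjI ballI allI impI)
    fix v assume "v \<in> tiling_vertices T"
    then show "0 < f v" using bspec[OF t] index_range(1)[of "t + v"] unfolding f_def by fastforce
  next
    fix l a b d c
    assume *: "convex hull {a, b, d, c} \<in> T \<and> (thick_rhombus l a b d c \<or> thin_rhombus l a b d c)"
    obtain u r s where rs: "r < 5" "s < 5" "r \<noteq> s"
      and R: "convex hull {a, b, d, c} = par u (zeta5 ^ r) (zeta5 ^ s)"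
      using penrose_tile_shape[OF T] * by metis
    have "par u (zeta5 ^ r) (zeta5 ^ s) \<in> T" using * R by simp
    note i = ti[OF rs this]
    have "f a * f d = f u * f (u + zeta5 ^ r + zeta5 ^ s)"
      using corners_of_tile(1)[OF rs R, of l] * by (auto simp: doubleton_eq_iff)
    moreover have "f b * f c = f (u + zeta5 ^ r) * f (u + zeta5 ^ s)"
      using corners_of_tile(2)[OF rs R, of l] * by (auto simp: doubleton_eq_iff)
    ultimately show "f b * f c - f a * f d = 1" unfolding i by (simp add: algebra_simps)
  qed
  moreover have "f ` tiling_vertices T = {1, 2, 3, 4}"
  proof
    show "f ` tiling_vertices T \<subseteq> {1, 2, 3, 4}"
      using t index_cases unfolding f_def by blast
    have lat: "\<forall>v\<in>tiling_vertices T. t + v \<in> lattice" using t by blast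
    have ex: "\<exists>u r s. r < 5 \<and> s < 5 \<and> r \<noteq> s \<and> par u (zeta5 ^ r) (zeta5 ^ s) \<in> T \<and> f u \<noteq> b" for b
      using not_base_constant[OF T, of t b] lat unfolding base_constant_def f_def by blast
    \<comment> \<open>a tile with base index different from \<open>3 - b\<close> has base index \<open>b\<close>\<close>
    have vals: "b \<in> f ` tiling_vertices T \<and> b + 1 \<in> f ` tiling_vertices T \<and>
        b + 2 \<in> f ` tiling_vertices T" if "b \<in> {1, 2}" for b
    proof -
      obtain u r s where rs: "r < 5" "s < 5" "r \<noteq> s" and R: "par u (zeta5 ^ r) (zeta5 ^ s) \<in> T"
        and "f u \<noteq> 3 - b" using ex[of "3 - b"] by blast
      then have "f u = b" using ti(1)[OF rs R] that by auto
      then show ?thesis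
        using ti[OF rs R] vertex_of_tile[OF rs R] by (metis image_eqI insertCI)
    qed
    show "{1, 2, 3, 4} \<subseteq> f ` tiling_vertices T" using vals[of 1] vals[of 2] by simp
  qed
  ultimately show ?thesis by (intro exI[of _ f]) simp
qed


section \<open>Similarities\<close>

text \<open>After removal of the translation and the factor, a map that preserves distances and fixes 0 is
  orthogonal.\<close>

lemma similarityE:
  assumes "similarity \<phi>"
  obtains c L where "0 < c" "linear L" "bij L" "\<And>z. \<phi> z = \<phi> 0 + L z"
    "\<And>x y. L x \<bullet> L y = c ^ 2 * (x \<bullet> y)"
proof -
  obtain c where c: "0 < c" "\<And>z w. dist (\<phi> z) (\<phi> w) = c * dist z w"
    using assms unfolding similarity_def by blast
  define g where "g z = (\<phi> z - \<phi> 0) /\<^sub>R c" for z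
  have "dist (g x) (g y) = dist x y" for x y
  proof -
    have "dist (g x) (g y) = norm ((\<phi> x - \<phi> y) /\<^sub>R c)"
      unfolding dist_norm g_def by (simp flip: scaleR_diff_right)
    then show ?thesis using c by (simp add: dist_norm)
  qed
  then have g: "orthogonal_transformation g"
    unfolding orthogonal_transformation_isometry by (simp add: g_def)
  show thesis
  proof (rule that[of c "\<lambda>z. c *\<^sub>R g z"])
    show "linear (\<lambda>z. c *\<^sub>R g z)"
      using orthogonal_transformation_linear[OF g] by (rule linear_compose_scale_right)
    have "bij ((*\<^sub>R) c :: complex \<Rightarrow> complex)"
      by (rule bij_betw_byWitness[where f'="(*\<^sub>R) (inverse c)"]) (use c in auto)
    then show "bij (\<lambda>z. c *\<^sub>R g z)"
      using bij_comp[OF orthogonal_transformation_bij[OF g]] by (simp add: comp_def)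
    show "\<phi> z = \<phi> 0 + c *\<^sub>R g z" for z using c by (simp add: g_def)
    show "c *\<^sub>R g x \<bullet> c *\<^sub>R g y = c ^ 2 * (x \<bullet> y)" for x y
      using g by (simp add: orthogonal_transformation_def power2_eq_square)
  qed (rule c(1))
qed

lemma similarity_frieze:
  assumes \<phi>: "similarity \<phi>" and f: "frieze_pattern T f"
  shows "\<exists>g. frieze_pattern ((\<lambda>R. \<phi> ` R) ` T) g \<and>
    g ` tiling_vertices ((\<lambda>R. \<phi> ` R) ` T) = f ` tiling_vertices T"
proof -
  obtain c L where c: "0 < c" and L: "linear L" "bij L" and \<phi>L: "\<And>z. \<phi> z = \<phi> 0 + L z"
    and inner: "\<And>x y. L x \<bullet> L y = c ^ 2 * (x \<bullet> y)"
    using similarityE[OF \<phi>] by metis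
  have image: "\<phi> ` S = (+) (\<phi> 0) ` L ` S" for S
    unfolding image_image by (rule image_cong[OF refl \<phi>L])
  have L_inj: "inj L" using L(2) by (rule bij_is_inj)
  have inj: "inj \<phi>" by (rule injI) (metis \<phi>L add_left_cancel L_inj injD)
  have surj: "\<exists>x. y = \<phi> x" for y
    using bij_is_surj[OF L(2)] by (metis \<phi>L surjD add.commute diff_add_cancel)
  have diff: "\<phi> x - \<phi> y = L (x - y)" for x y
    unfolding \<phi>L[of x] \<phi>L[of y] by (simp add: linear_diff[OF L(1)])
  have norm: "norm (L x) = c * norm x" for x
    using c by (simp add: norm_eq_sqrt_inner inner real_sqrt_mult)
  have hull: "convex hull (\<phi> ` S) = \<phi> ` (convex hull S)" for S
    unfolding image convex_hull_translation convex_hull_linear_image[OF L(1)] ..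
  have extreme: "\<phi> v extreme_point_of \<phi> ` R \<longleftrightarrow> v extreme_point_of R" for v R
    unfolding image \<phi>L[of v] extreme_point_of_translation_eq
    using face_of_linear_image[OF L(1) L_inj, of "{v}" R] by (simp add: face_of_singleton)
  have vertices: "tiling_vertices ((\<lambda>R. \<phi> ` R) ` T) = \<phi> ` tiling_vertices T"
  proof (rule set_eqI)
    fix y
    obtain x where "y = \<phi> x" using surj by blast
    then show "y \<in> tiling_vertices ((\<lambda>R. \<phi> ` R) ` T) \<longleftrightarrow> y \<in> \<phi> ` tiling_vertices T"
      unfolding tiling_vertices_def using inj by (auto simp: extreme inj_image_mem_iff)
  qed
  have rhombus: "rhombus (l / c) \<alpha> p q r s" if "rhombus l \<alpha> (\<phi> p) (\<phi> q) (\<phi> r) (\<phi> s)"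
    for l \<alpha> p q r s
  proof -
    have "angle_at (\<phi> p) (\<phi> q) (\<phi> s) = angle_at p q s"
      unfolding angle_at_def diff inner norm using c by (simp add: power2_eq_square mult.assoc mult.left_commute)
    moreover have "q - p = r - s"
      using that L_inj unfolding rhombus_def diff by (simp add: inj_eq)
    moreover have "dist (\<phi> x) (\<phi> y) = c * dist x y" for x y
      unfolding dist_norm diff norm ..
    ultimately show ?thesis using that c unfolding rhombus_def by (simp add: field_simps)
  qed
  define g where "g y = f (inv \<phi> y)" for y
  have g: "g (\<phi> x) = f x" for x using inj by (simp add: g_def)
  have "frieze_pattern ((\<lambda>R. \<phi> ` R) ` T) g"
    unfolding frieze_pattern_def vertices
  proof (intro conjI ballI allI impI)
    fix v assume "v \<in> \<phi> ` tiling_vertices T"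
    then show "0 < g v" using f unfolding frieze_pattern_def by (auto simp: g)
  next
    fix l a' b' d' c'
    assume *: "convex hull {a', b', d', c'} \<in> (\<lambda>R. \<phi> ` R) ` T \<and>
      (thick_rhombus l a' b' d' c' \<or> thin_rhombus l a' b' d' c')"
    obtain a b d e where eqs: "a' = \<phi> a" "b' = \<phi> b" "d' = \<phi> d" "c' = \<phi> e" using surj by metis
    have "\<phi> ` (convex hull {a, b, d, e}) \<in> (\<lambda>R. \<phi> ` R) ` T"
      using * hull[of "{a, b, d, e}"] by (simp add: eqs)
    then have "convex hull {a, b, d, e} \<in> T" using inj by (auto simp: inj_image_eq_iff)
    moreover have "thick_rhombus (l / c) a b d e \<or> thin_rhombus (l / c) a b d e"
      using * rhombus unfolding eqs thick_rhombus_def thin_rhombus_def by blast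
    ultimately have "f b * f e - f a * f d = 1" using f unfolding frieze_pattern_def by blast
    then show "g b' * g c' - g a' * g d' = 1" by (simp add: eqs g)
  qed
  moreover have "g ` tiling_vertices ((\<lambda>R. \<phi> ` R) ` T) = f ` tiling_vertices T"
    unfolding vertices image_image g ..
  ultimately show ?thesis by blast
qed

theorem theorem2p1:
  fixes T :: "complex set set"
  assumes "penrose_tiling T"
  shows "\<exists>f :: complex \<Rightarrow> int. frieze_pattern T f \<and> card (f ` tiling_vertices T) = 4"
proof -
  obtain \<phi> T0 where \<phi>: "similarity \<phi>" "unit_penrose_tiling T0" "T = (\<lambda>R. \<phi> ` R) ` T0"
    using assms unfolding penrose_tiling_def by blast
  obtain f :: "complex \<Rightarrow> int" where "frieze_pattern T0 f" "card (f ` tiling_vertices T0) = 4"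
    using unit_penrose_frieze[OF \<phi>(2)] by blast
  then show ?thesis using similarity_frieze[OF \<phi>(1)] unfolding \<phi>(3) by metis
qed

end
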